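(* For a marked graph diagram $D$, define $$R'_D(z)=z^{t_+(D)}\,[D](0,0,z,z^{-1})\in\mathbb Z[z,z^{-1}].$$ Then $R'_D(z)$ is invariant under all Yoshikawa moves; that is, if $D'$ is obtained from $D$ by any one of the Yoshikawa moves $\Omega_1,\Omega_2,\Omega_3,\Omega_4,\Omega_4',\Omega_5,\Omega_6,\Omega_6',\Omega_7,\Omega_8$ (in either direction), then $R'_{D'}(z)=R'_D(z)$.
   Context: **Marked graph diagrams.** A marked graph diagram $D$ is a link diagram in $\mathbb R^2$ possibly with some $4$-valent marked vertices: a generic planar diagram whose double points are finitely many classical crossings (with over/under information) and finitely many marked vertices. Near a marked vertex the diagram looks like the letter X, and the vertex carries a marker, a short segment through the vertex lying in one pair of opposite sectors of the X. Diagrams are considered up to isotopy of the plane and are unoriented. A link diagram is a marked graph diagram without marked vertices. In pictures, the four arms at a crossing or vertex are called NW, NE, SW, SE; a horizontal marker lies in the left and right sectors, a vertical marker in the upper and lower sectors. **State-sum.** $\widehat D$ is obtained from $D$ by removing all classical crossings (so both strands are cut at each crossing), while marked vertices are not removed (so the four arms at a marked vertex belong to the same component of $\widehat D$). A state is a map $\sigma$ from the set of connected components of $\widehat D$ to $\{0,1\}$. It is legal if at each classical crossing each label occurs an even number of times among the four arm-ends. For a legal state $\sigma$ and a classical crossing $c$, rotate the picture so that the over-strand joins SW and NE. With $a\ne b$ the two labels, $\nu(c,\sigma)$ is: $x$ if all four labels are equal; $y$ if NW$=$SE$=a$ and NE$=$SW$=b$; $z$ if NW$=$NE$=a$ and SW$=$SE$=b$;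 $w$ if NW$=$SW$=a$ and NE$=$SE$=b$. Then $$[D]=[D](x,y,z,w)=\sum_{\text{legal states }\sigma}\ \prod_{\text{classical crossings }c}\nu(c,\sigma)\in\mathbb Z[x,y,z,w].$$ **Positive resolution and $t_+$.** The positive resolution diagram $D_+$ is the link diagram obtained from $D$ by smoothing each marked vertex along its marker: for a horizontal marker, the X is replaced by one arc joining the NW and NE arms and one arc joining the SW and SE arms, parallel to the marker. $t_+(D)=sw(D_+)$ is the self-writhe of $D_+$: the sum, over the components of the link, of the writhe of the sub-diagram of that component (only crossings of a component with itself count; a crossing is positive if, rotated so that both strands point upward, the over-strand runs from SW to NE). **Yoshikawa moves.** Each move replaces the part of the diagram in a disk by another one with the same boundary points, the rest being unchanged (moves may be used in both directions, up to isotopy of the plane). - $\Omega_1$: a crossing with over-strand SW–NE, whose NE and SE arms are joined by an arc on the right and whose NW and SW arms go to the boundary, $\leftrightarrow$ a simple arc. - $\Omega_2$: two arcs, the left one passing over the right one at two crossings that bound a bigon, $\leftrightarrow$ two disjoint arcs. - $\Omega_3$: two straight strands crossing at a point, the NW–SE strand over the SW–NE strand, and a third, left-to-right, strand $H$ passing over both; $H$ passes below the crossing point (crossing its SW and SE arms) $\leftrightarrow$ $H$ passes above it (crossing the NW and NE arms). - $\Omega_4$: a marked vertex with horizontal marker and a left-to-right strand $H$; $H$ passes over the SW and SE arms $\leftrightarrow$ $H$ passes over the NW and NE arms. - $\Omega_4'$: as $\Omega_4$, but $H$ passes under the arms. - $\Omega_5$: a crossing with over-strand SW–NE on the left and a marked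 vertex with horizontal marker on the right, with the NE (resp. SE) arm of the crossing joined to the NW (resp. SW) arm of the vertex, the other four arms going to the boundary, $\leftrightarrow$ the marked vertex with horizontal marker on the left and a crossing with over-strand SW–NE on the right, joined in the same way. - $\Omega_6$: a marked vertex with vertical marker whose NE and SE arms are joined by an arc on the right and whose NW and SW arms go to the boundary $\leftrightarrow$ a simple arc. - $\Omega_6'$: as $\Omega_6$, with horizontal marker. - $\Omega_7$: a disk with boundary points $t_1,t_2,t_3$ on top and $b_1,b_2,b_3$ at the bottom (left to right), no crossings. One side: a lower-left vertex $v$ with vertical marker and an upper-right vertex $v'$ with horizontal marker; $v$ has SW to $b_1$, NW to $t_1$, SE to $b_2$, NE joined to the SW arm of $v'$; $v'$ has NW to $t_2$, NE to $t_3$, SE to $b_3$. Other side: an upper-left vertex $u$ with vertical marker and a lower-right vertex $u'$ with horizontal marker; $u$ has NW to $t_1$, NE to $t_2$, SW to $b_1$, SE joined to the NW arm of $u'$; $u'$ has SW to $b_2$, SE to $b_3$, NE to $t_3$. - $\Omega_8$: a disk with boundary points $t_1,\dots,t_4$ on top and $b_1,\dots,b_4$ at the bottom. A left vertex $v$ with vertical marker has NW to $t_1$, NE to $t_2$, SW to $b_3$, SE to $b_4$; a right vertex $v'$ with horizontal marker has NW to $t_3$, NE to $t_4$, SW to $b_1$, SE to $b_2$; the two parallel lower arms of $v$ cross the two parallel lower arms of $v'$ in exactly four crossings. On one side the arms of $v'$ are over at all four crossings $\leftrightarrow$ on the other side the arms of $v$ are over at all four crossings. *)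

theory Defs
  imports Complex_Main "HOL-Library.Multiset" "HOL-Library.Poly_Mapping" "HOL-Library.FuncSet"
begin

section \<open>Planar diagram codes\<close>

text \<open>
  A marked graph diagram is cut into finitely many elementary pieces along points (the
  labels, natural numbers) lying on the curve away from the double points.  A piece is an arc
  without double points with its two end points, a classical crossing with its four arms, or a
  marked vertex with its four arms.  A diagram is the list of its pieces; pieces are glued
  where they share a label.  A closed curve without double points is \<open>Arc p p\<close>.

  Crossings are drawn with the over-strand joining SW and NE, marked vertices with a horizontal
  marker.  The other positions are obtained by rotating the picture by a quarter turn.
\<close>

datatype 'a piece =
    Arc 'a 'a
  | Crossing (nw: 'a) (ne: 'a) (sw: 'a) (se: 'a)
  | Vertex 'a 'a 'a 'a

type_synonym diagram = "nat piece list"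

fun is_crossing :: "'a piece \<Rightarrow> bool" where
  "is_crossing (Crossing _ _ _ _) = True"
| "is_crossing (Arc _ _) = False"
| "is_crossing (Vertex _ _ _ _) = False"

text \<open>The ends of a piece, listed counterclockwise (NE, NW, SW, SE).\<close>

fun ends :: "'a piece \<Rightarrow> 'a list" where
  "ends (Arc p q) = [p, q]"
| "ends (Crossing a b c d) = [b, a, c, d]"
| "ends (Vertex a b c d) = [b, a, c, d]"

definition labels :: "'a piece list \<Rightarrow> 'a set" where
  "labels D = (\<Union>P\<in>set D. set_piece P)"

text \<open>A dart \<open>(i, k)\<close> is the \<open>k\<close>-th end of the \<open>i\<close>-th piece.\<close>

definition darts :: "'a piece list \<Rightarrow> (nat \<times> nat) set" where
  "darts D = {(i, k). i < length D \<and> k < length (ends (D ! i))}"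

fun dart_label :: "'a piece list \<Rightarrow> nat \<times> nat \<Rightarrow> 'a" where
  "dart_label D (i, k) = ends (D ! i) ! k"

text \<open>The next end, counterclockwise, of the same piece; and the other end of the same strand.\<close>

fun next_dart :: "'a piece list \<Rightarrow> nat \<times> nat \<Rightarrow> nat \<times> nat" where
  "next_dart D (i, k) = (i, (k + 1) mod length (ends (D ! i)))"

fun opposite_dart :: "'a piece list \<Rightarrow> nat \<times> nat \<Rightarrow> nat \<times> nat" where
  "opposite_dart D (i, k) = (i, (k + length (ends (D ! i)) div 2) mod length (ends (D ! i)))"

definition glued :: "'a piece list \<Rightarrow> ((nat \<times> nat) \<times> (nat \<times> nat)) set" where
  "glued D = {(d, d'). d \<in> darts D \<and> d' \<in> darts D \<and> d \<noteq> d' \<and> dart_label D d = dart_label D d'}"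

definition closed_code :: "'a piece list \<Rightarrow> bool" where
  "closed_code D \<longleftrightarrow> (\<forall>p\<in>labels D. count_list (concat (map ends D)) p = 2)"

definition generated_equiv :: "'b set \<Rightarrow> ('b \<times> 'b) set \<Rightarrow> ('b \<times> 'b) set" where
  "generated_equiv A R = (R \<union> R\<inverse>)\<^sup>* \<inter> A \<times> A"

text \<open>
  Planarity.  The code is a combinatorial map whose vertices are the pieces and whose edges are
  the labels; a face is an orbit of the permutation ``cross the gluing, then turn to the next
  end''.  The condition is Euler's formula \<open>V - E + F = 2 C\<close>, where \<open>C\<close> is the number of
  connected components of the underlying graph: every component has genus 0.
\<close>

definition faces :: "'a piece list \<Rightarrow> (nat \<times> nat) set set" where
  "faces D = darts D // generated_equiv (darts D) {(d, next_dart D d') | d d'. (d, d') \<in> glued D}"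

definition graph_components :: "'a piece list \<Rightarrow> (nat \<times> nat) set set" where
  "graph_components D =
     darts D // generated_equiv (darts D) ({(d, next_dart D d) | d. d \<in> darts D} \<union> glued D)"

definition planar_code :: "'a piece list \<Rightarrow> bool" where
  "planar_code D \<longleftrightarrow>
     length D + card (faces D) = card (labels D) + 2 * card (graph_components D)"

definition marked_graph_diagram :: "diagram \<Rightarrow> bool" where
  "marked_graph_diagram D \<longleftrightarrow> closed_code D \<and> planar_code D"


section \<open>The state-sum\<close>

text \<open>
  \<open>\<widehat>D\<close> is obtained by removing the crossings.  Every component of it carries a label, so its
  components are the classes of labels joined by the remaining pieces.
\<close>

definition hat_equiv :: "diagram \<Rightarrow> (nat \<times> nat) set" where
  "hat_equiv D = generated_equiv (labels D)
     {(p, q). \<exists>P\<in>set D. \<not> is_crossing P \<and> p \<in> set_piece P \<and> q \<in> set_piece P}"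

definition hat_components :: "diagram \<Rightarrow> nat set set" where
  "hat_components D = labels D // hat_equiv D"

definition states :: "diagram \<Rightarrow> (nat set \<Rightarrow> nat) set" where
  "states D = hat_components D \<rightarrow>\<^sub>E {0, 1}"

definition state_at :: "diagram \<Rightarrow> (nat set \<Rightarrow> nat) \<Rightarrow> nat \<Rightarrow> nat" where
  "state_at D s p = s (hat_equiv D `` {p})"

definition legal :: "diagram \<Rightarrow> (nat set \<Rightarrow> nat) \<Rightarrow> bool" where
  "legal D s \<longleftrightarrow>
     (\<forall>P\<in>set D. is_crossing P \<longrightarrow>
        (\<forall>l\<in>{0, 1}. even (count_list (map (state_at D s) (ends P)) l)))"

definition weight :: "'r \<Rightarrow> 'r \<Rightarrow> 'r \<Rightarrow> 'r \<Rightarrow> nat \<Rightarrow> nat \<Rightarrow> nat \<Rightarrow> nat \<Rightarrow> 'r::comm_ring_1" where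
  "weight x y z w lnw lne lsw lse =
     (if lnw = lne \<and> lne = lsw \<and> lsw = lse then x
      else if lnw = lse \<and> lne = lsw then y
      else if lnw = lne \<and> lsw = lse then z
      else if lnw = lsw \<and> lne = lse then w
      else 0)" \<comment> \<open>the last case does not occur in a legal state\<close>

definition nu :: "diagram \<Rightarrow> 'r \<Rightarrow> 'r \<Rightarrow> 'r \<Rightarrow> 'r \<Rightarrow> (nat set \<Rightarrow> nat) \<Rightarrow> nat piece \<Rightarrow> 'r::comm_ring_1" where
  "nu D x y z w s c =
     weight x y z w (state_at D s (nw c)) (state_at D s (ne c)) (state_at D s (sw c)) (state_at D s (se c))"

text \<open>
  The polynomial \<open>[D]\<close>, given by its value at any \<open>x, y, z, w\<close> in any commutative ring.
\<close>

definition bracket :: "diagram \<Rightarrow> 'r \<Rightarrow> 'r \<Rightarrow> 'r \<Rightarrow> 'r \<Rightarrow> 'r::comm_ring_1" where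
  "bracket D x y z w =
     (\<Sum>s | s \<in> states D \<and> legal D s. \<Prod>c\<leftarrow>filter is_crossing D. nu D x y z w s c)"


section \<open>Positive resolution and self-writhe\<close>

fun smooth :: "'a piece \<Rightarrow> 'a piece list" where
  "smooth (Vertex a b c d) = [Arc a b, Arc c d]"
| "smooth (Arc p q) = [Arc p q]"
| "smooth (Crossing a b c d) = [Crossing a b c d]"

definition positive_resolution :: "diagram \<Rightarrow> diagram" where
  "positive_resolution D = concat (map smooth D)"

text \<open>The functions from here to \<open>self_writhe\<close> are meant for codes without vertices.\<close>

definition link_components :: "diagram \<Rightarrow> nat set set" where
  "link_components L = labels L // generated_equiv (labels L)
     {(dart_label L d, dart_label L (opposite_dart L d)) | d. d \<in> darts L}"

text \<open>An orientation tells for each dart whether the strand leaves its piece there.\<close>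

definition orientation :: "diagram \<Rightarrow> (nat \<times> nat \<Rightarrow> bool) \<Rightarrow> bool" where
  "orientation L out \<longleftrightarrow>
     (\<forall>d\<in>darts L. out (opposite_dart L d) \<noteq> out d) \<and>
     (\<forall>(d, d')\<in>glued L. out d' \<noteq> out d)"

text \<open>
  Darts 0 and 1 of a crossing are its NE and NW arms.  With the over-strand running from SW to
  NE, both strands point upward iff the under-strand leaves at NW.
\<close>

definition crossing_sign :: "(nat \<times> nat \<Rightarrow> bool) \<Rightarrow> nat \<Rightarrow> int" where
  "crossing_sign out i = (if out (i, 0) = out (i, 1) then 1 else - 1)"

definition component_writhe :: "diagram \<Rightarrow> (nat \<times> nat \<Rightarrow> bool) \<Rightarrow> nat set \<Rightarrow> int" where
  "component_writhe L out K =
     (\<Sum>i | i < length L \<and> is_crossing (L ! i) \<and> set_piece (L ! i) \<subseteq> K. crossing_sign out i)"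

text \<open>The diagrams are unoriented; the self-writhe does not depend on the orientation chosen.\<close>

definition self_writhe :: "diagram \<Rightarrow> int" where
  "self_writhe L = (\<Sum>K\<in>link_components L. component_writhe L (SOME out. orientation L out) K)"

definition t_plus :: "diagram \<Rightarrow> int" where
  "t_plus D = self_writhe (positive_resolution D)"


section \<open>The Laurent polynomial\<close>

text \<open>\<open>int \<Rightarrow>\<^sub>0 int\<close> with convolution is the ring of integral Laurent polynomials in one variable.\<close>

type_synonym laurent = "int \<Rightarrow>\<^sub>0 int"

definition zpow :: "int \<Rightarrow> laurent" where
  "zpow n = Poly_Mapping.single n 1"

definition R_prime :: "diagram \<Rightarrow> laurent" where
  "R_prime D = zpow (t_plus D) * bracket D 0 0 (zpow 1) (zpow (- 1))"


section \<open>Isotopy\<close>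

text \<open>
  Codes of the same diagram: pieces in another order, other names of the labels, an arc read
  backwards, a crossing or vertex turned by a half turn, a cut point removed.
\<close>

inductive recode :: "diagram \<Rightarrow> diagram \<Rightarrow> bool" where
  permute: "mset D = mset E \<Longrightarrow> recode D E"
| rename: "inj_on f (labels D) \<Longrightarrow> recode D (map (map_piece f) D)"
| flip_arc: "recode (Arc p q # D) (Arc q p # D)"
| turn_crossing: "recode (Crossing a b c d # D) (Crossing d c b a # D)"
| turn_vertex: "recode (Vertex a b c d # D) (Vertex d c b a # D)"
| remove_point: "p \<noteq> q \<Longrightarrow> recode (Arc p q # D) (map (map_piece (id(q := p))) D)"

definition isotopic :: "diagram \<Rightarrow> diagram \<Rightarrow> bool" where
  "isotopic = equivclp (\<lambda>D E. marked_graph_diagram D \<and> marked_graph_diagram E \<and> recode D E)"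


section \<open>Yoshikawa moves\<close>

text \<open>
  Quarter turns: a crossing with over-strand NW--SE and a vertex with vertical marker, arguments
  in the order NW, NE, SW, SE.
\<close>

abbreviation (input) CrossingNWSE :: "'a \<Rightarrow> 'a \<Rightarrow> 'a \<Rightarrow> 'a \<Rightarrow> 'a piece" where
  "CrossingNWSE a b c d \<equiv> Crossing c a d b"

abbreviation (input) VertexV :: "'a \<Rightarrow> 'a \<Rightarrow> 'a \<Rightarrow> 'a \<Rightarrow> 'a piece" where
  "VertexV a b c d \<equiv> Vertex c a d b"

text \<open>
  A left-to-right strand from \<open>l\<close> to \<open>r\<close> passing over, or under, a strand with upper end \<open>u\<close>
  and lower end \<open>d\<close> (the picture is turned by 45 degrees).
\<close>

abbreviation (input) Over :: "'a \<Rightarrow> 'a \<Rightarrow> 'a \<Rightarrow> 'a \<Rightarrow> 'a piece" where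
  "Over l r u d \<equiv> Crossing u r l d"

abbreviation (input) Under :: "'a \<Rightarrow> 'a \<Rightarrow> 'a \<Rightarrow> 'a \<Rightarrow> 'a piece" where
  "Under l r u d \<equiv> Crossing l u d r"

datatype move =
  Omega1 | Omega2 | Omega3 | Omega4 | Omega4' | Omega5 | Omega6 | Omega6' | Omega7 | Omega8

text \<open>
  The contents of the disk before and after a move.  The labels occurring once on a side are the
  boundary points of the disk; those occurring twice are interior.  Boundary labels
  may coincide, namely when the outside joins the two boundary points by a plain arc.
\<close>

inductive local_move :: "move \<Rightarrow> diagram \<Rightarrow> diagram \<Rightarrow> bool" where
  omega1: "local_move Omega1
     [Crossing a e b e]
     [Arc a b]"
| omega2: "local_move Omega2 \<comment> \<open>left arc from \<open>a\<close> to \<open>b\<close>, right arc from \<open>c\<close> to \<open>d\<close>, downwards\<close>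
     [CrossingNWSE a c e f, Crossing e f b d]
     [Arc a b, Arc c d]"
| omega3: "local_move Omega3
     [CrossingNWSE t1 t2 e f, Over h1 g e b1, Over g h2 f b2]
     [Over h1 g t1 e, Over g h2 t2 f, CrossingNWSE e f b1 b2]"
| omega4: "local_move Omega4
     [Vertex t1 t2 e f, Over h1 g e b1, Over g h2 f b2]
     [Over h1 g t1 e, Over g h2 t2 f, Vertex e f b1 b2]"
| omega4': "local_move Omega4'
     [Vertex t1 t2 e f, Under h1 g e b1, Under g h2 f b2]
     [Under h1 g t1 e, Under g h2 t2 f, Vertex e f b1 b2]"
| omega5: "local_move Omega5
     [Crossing a e b f, Vertex e c f d]
     [Vertex a e b f, Crossing e c f d]"
| omega6: "local_move Omega6
     [VertexV a e b e]
     [Arc a b]"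
| omega6': "local_move Omega6'
     [Vertex a e b e]
     [Arc a b]"
| omega7: "local_move Omega7
     [VertexV t1 e b1 b2, Vertex t2 t3 e b3]
     [VertexV t1 t2 b1 e, Vertex e t3 b2 b3]"
| omega8: "local_move Omega8
     \<comment> \<open>\<open>e1, e2\<close> and \<open>f1, f2\<close>: SW and SE arm of the left vertex, \<open>g1, g2\<close> and \<open>h1, h2\<close>: those of
        the right vertex; crossings in the order top, left, right, bottom\<close>
     [VertexV t1 t2 e1 f1, Vertex t3 t4 g1 h1,
      Crossing f1 g1 g2 f2, Crossing e1 g2 b1 e2, Crossing f2 h1 h2 b4, Crossing e2 h2 b2 b3]
     [VertexV t1 t2 e1 f1, Vertex t3 t4 g1 h1,
      CrossingNWSE f1 g1 g2 f2, CrossingNWSE e1 g2 b1 e2, CrossingNWSE f2 h1 h2 b4,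
      CrossingNWSE e2 h2 b2 b3]"

text \<open>\<open>S\<close> is the part of the diagram outside the disk.\<close>

definition yoshikawa_move :: "move \<Rightarrow> diagram \<Rightarrow> diagram \<Rightarrow> bool" where
  "yoshikawa_move m D D' \<longleftrightarrow>
     (\<exists>T T' S. (local_move m T T' \<or> local_move m T' T) \<and>
        isotopic D (T @ S) \<and> isotopic (T' @ S) D')"

end

theory Submission
  imports Defs
begin

text \<open>
  Both factors of \<open>R'\<close> are computed locally, so it suffices to compare the two disks of each
  move; the two factors change only under \<open>\<Omega>\<^sub>1\<close>, by powers of \<open>z\<close> that cancel.

  The bracket.  Let the arcs and the vertices carry the indicator that all their labels have the
  same colour, and the crossings their weight.  Then the bracket is the sum, over all
  two-colourings of the labels, of the product of the factors of the pieces
  (\<open>bracket_eq_contraction\<close>).  Hence it depends on the disk of a move only through the function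
  obtained by summing over the colours of the interior labels (\<open>bracket_replace\<close>).  At
  \<open>x = y = 0\<close> a crossing contributes \<open>0\<close> unless the colour changes along both of its strands, so
  the boundary colours determine the interior ones, and \<open>z * w = 1\<close> cancels the crossings of the
  bigon in \<open>\<Omega>\<^sub>2\<close>, the two crossings in \<open>\<Omega>\<^sub>4\<close> and the four in \<open>\<Omega>\<^sub>8\<close>.  The kink of \<open>\<Omega>\<^sub>1\<close>
  contributes \<open>w = z\<^sup>-\<^sup>1\<close> (\<open>bracket_local_move\<close>).

  The self-writhe.  After the smoothing along the markers, the two disks of every move join their
  boundary points in the same pairs, up to closed curves without crossings.  Hence the outside
  sees the same components, and an orientation of one diagram carries over to the other with the
  same directions at the boundary points.  The signs of the crossings outside, and
  whether they are self-crossings, do not change, and the self-crossings inside the two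
  disks have the same total sign, except that the kink of \<open>\<Omega>\<^sub>1\<close> counts \<open>+ 1\<close> (\<open>self_writhe_replace\<close>,
  \<open>t_plus_local_move\<close>).  For \<open>\<Omega>\<^sub>4\<close> and \<open>\<Omega>\<^sub>8\<close> the reason is that a smoothed vertex turns two of
  its arms into one arc, which crosses another strand once in each direction.

  For this argument one has to know that a closed code has an orientation
  (\<open>eulerian_orientation\<close>) and that the sign of a self-crossing is the same for all
  orientations (\<open>orientations_agree\<close>), so that any convenient orientation computes the self-writhe
  (\<open>self_writhe_eq_total_self_sign\<close>).  Independence of the code chosen for a diagram is proved
  for both factors along the same lines.
\<close>

section \<open>Colourings of the labels and the bracket\<close>

lemma generated_equiv_equiv: "equiv A (generated_equiv A R)"
proof -
  have "sym ((R \<union> R\<inverse>)\<^sup>*)" by (rule sym_rtrancl) (auto simp: sym_def)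
  then show ?thesis
    unfolding generated_equiv_def equiv_def
    by (auto simp: refl_on_def sym_def trans_def intro: rtrancl_trans)
qed

text \<open>
  The set of points that can be reached from a given point is itself an invariant, so two-valued
  invariants separate the classes.  Statements about components thus become statements about
  functions constant along the curve, which can be prescribed label by label.
\<close>

lemma generated_equiv_iff_invariants:
  "(x, y) \<in> generated_equiv A R \<longleftrightarrow>
     x \<in> A \<and> y \<in> A \<and> (\<forall>g :: 'b \<Rightarrow> bool. (\<forall>(p, q)\<in>R. g p = g q) \<longrightarrow> g x = g y)"
proof -
  have 1: "g x = g y" if "(x, y) \<in> (R \<union> R\<inverse>)\<^sup>*" "\<forall>(p, q)\<in>R. g p = g q" for g :: "'b \<Rightarrow> bool"
    using that by (induction rule: rtrancl_induct) auto
  have 2: "(x, y) \<in> (R \<union> R\<inverse>)\<^sup>*" if "\<And>g :: 'b \<Rightarrow> bool. (\<forall>(p, q)\<in>R. g p = g q) \<Longrightarrow> g x = g y"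
  proof -
    have "\<forall>(p, q)\<in>R. ((x, p) \<in> (R \<union> R\<inverse>)\<^sup>*) = ((x, q) \<in> (R \<union> R\<inverse>)\<^sup>*)"
      by (auto intro: rtrancl_into_rtrancl)
    from that[OF this] show ?thesis by simp
  qed
  show ?thesis unfolding generated_equiv_def using 1 2 by blast
qed

lemma finite_labels [simp]: "finite (labels D)"
proof -
  have "finite (set_piece P)" for P :: "'a piece" by (cases P) auto
  then show ?thesis by (auto simp: labels_def)
qed

lemma labels_append [simp]: "labels (D @ E) = labels D \<union> labels E"
  by (auto simp: labels_def)

lemma labels_Nil [simp]: "labels [] = {}"
  by (auto simp: labels_def)

lemma labels_Cons [simp]: "labels (P # D) = set_piece P \<union> labels D"
  by (auto simp: labels_def)

text \<open>
  Arcs and vertices carry the indicator of being monochromatic: this turns the sum over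
  states into a sum over all colourings of the labels.
\<close>

fun local_weight :: "'r \<Rightarrow> 'r \<Rightarrow> 'r \<Rightarrow> 'r \<Rightarrow> ('a \<Rightarrow> bool) \<Rightarrow> 'a piece \<Rightarrow> 'r::comm_ring_1" where
  "local_weight x y z w l (Arc p q) = of_bool (l p = l q)"
| "local_weight x y z w l (Crossing a b c d) =
     weight x y z w (of_bool (l a)) (of_bool (l b)) (of_bool (l c)) (of_bool (l d))"
| "local_weight x y z w l (Vertex a b c d) = of_bool (l a = l b \<and> l b = l c \<and> l c = l d)"

definition total_weight :: "'r \<Rightarrow> 'r \<Rightarrow> 'r \<Rightarrow> 'r \<Rightarrow> ('a \<Rightarrow> bool) \<Rightarrow> 'a piece list \<Rightarrow> 'r::comm_ring_1" where
  "total_weight x y z w l D = (\<Prod>P\<leftarrow>D. local_weight x y z w l P)"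

lemma total_weight_append [simp]:
  "total_weight x y z w l (D @ E) = total_weight x y z w l D * total_weight x y z w l E"
  by (simp add: total_weight_def)

lemma local_weight_cong:
  "(\<And>p. p \<in> set_piece P \<Longrightarrow> l p = l' p) \<Longrightarrow> local_weight x y z w l P = local_weight x y z w l' P"
  by (cases P) auto

lemma total_weight_cong:
  "(\<And>p. p \<in> labels D \<Longrightarrow> l p = l' p) \<Longrightarrow> total_weight x y z w l D = total_weight x y z w l' D"
  unfolding total_weight_def
  by (intro arg_cong[of _ _ prod_list] map_cong refl local_weight_cong) (auto simp: labels_def)

lemma prod_list_zero_member: "x \<in> set xs \<Longrightarrow> f x = 0 \<Longrightarrow> (\<Prod>x\<leftarrow>xs. f x) = (0::'r::comm_ring_1)"
  by (induction xs) auto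

lemma local_weight_non_crossing:
  assumes "\<not> is_crossing P"
  shows "local_weight x y z w l P = of_bool (\<forall>p\<in>set_piece P. \<forall>q\<in>set_piece P. l p = l q)"
proof (cases P)
  case (Arc p q)
  then show ?thesis by (simp add: eq_commute)
next
  case (Vertex a b c d)
  have "(l a = l b \<and> l b = l c \<and> l c = l d) =
      (\<forall>p\<in>{a, b, c, d}. \<forall>q\<in>{a, b, c, d}. l p = l q)" by blast
  then show ?thesis using Vertex by simp
qed (use assms in simp)

text \<open>
  At an illegal crossing three arms have one colour and the fourth the other, which fits none of
  the four patterns.  So illegal states can be kept in the sum.
\<close>

lemma weight_illegal:
  assumes "\<not> (\<forall>l\<in>{0, 1}. even (count_list [of_bool b, of_bool a, of_bool c, of_bool d :: nat] l))"
  shows "weight x y z w (of_bool a) (of_bool b) (of_bool c) (of_bool d) = 0"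
  using assms by (cases a; cases b; cases c; cases d; simp add: weight_def)

text \<open>
  A state is the same thing as a colouring of the labels that is constant on every arc and every
  vertex.  All other colourings contribute \<open>0\<close>.
\<close>

lemma bracket_eq_contraction:
  "bracket D x y z w = (\<Sum>l\<in>labels D \<rightarrow>\<^sub>E UNIV. total_weight x y z w l D)"
proof -
  define C where "C = {l \<in> labels D \<rightarrow>\<^sub>E (UNIV :: bool set).
      \<forall>P\<in>set D. \<not> is_crossing P \<longrightarrow> (\<forall>p\<in>set_piece P. \<forall>q\<in>set_piece P. l p = l q)}"
  \<comment> \<open>\<open>\<phi>\<close> and \<open>\<psi>\<close> translate between states and colourings; they are inverse to each
    other on the colourings \<open>C\<close> that respect the arcs and the vertices.\<close>
  define \<phi> where "\<phi> s = (\<lambda>p\<in>labels D. s (hat_equiv D `` {p}) = (1::nat))" for s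
  define \<psi> where "\<psi> l = (\<lambda>K\<in>hat_components D. of_bool (l (SOME p. p \<in> K)) :: nat)" for l ::
      "nat \<Rightarrow> bool"
  have eqv: "equiv (labels D) (hat_equiv D)"
    unfolding hat_equiv_def by (rule generated_equiv_equiv)
  have cls: "hat_equiv D `` {p} \<in> hat_components D" if "p \<in> labels D" for p
    using that by (auto simp: hat_components_def quotient_def)
  have at: "state_at D s p = of_bool (\<phi> s p)" if "s \<in> states D" "p \<in> labels D" for s p
  proof -
    have "s (hat_equiv D `` {p}) \<in> {0, 1}"
      using that cls[of p] by (auto simp: states_def PiE_iff)
    then show ?thesis using that by (auto simp: state_at_def \<phi>_def)
  qed
  have same: "hat_equiv D `` {p} = hat_equiv D `` {q}"
    if "P \<in> set D" "\<not> is_crossing P" "p \<in> set_piece P" "q \<in> set_piece P" for P p q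
  proof -
    have "(p, q) \<in> hat_equiv D"
      using that unfolding hat_equiv_def generated_equiv_def by (auto simp: labels_def)
    then show ?thesis using eqv by (simp add: equiv_class_eq_iff)
  qed
  have const: "l p = l q" if "l \<in> C" "(p, q) \<in> hat_equiv D" for l p q
  proof -
    have "\<forall>(p, q)\<in>{(p, q). \<exists>P\<in>set D. \<not> is_crossing P \<and> p \<in> set_piece P \<and> q \<in> set_piece P}. l p = l q"
      using that(1) unfolding C_def by blast
    with that(2) show ?thesis
      unfolding hat_equiv_def generated_equiv_iff_invariants by blast
  qed
  have \<phi>C: "\<phi> s \<in> C" if "s \<in> states D" for s
  proof -
    have "\<phi> s p = \<phi> s q"
      if P: "P \<in> set D" "\<not> is_crossing P" "p \<in> set_piece P" "q \<in> set_piece P" for P p q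
      using same[OF P] P by (auto simp: \<phi>_def labels_def)
    moreover have "\<phi> s \<in> labels D \<rightarrow>\<^sub>E UNIV" by (simp add: PiE_iff \<phi>_def)
    ultimately show ?thesis unfolding C_def by blast
  qed
  have \<psi>S: "\<psi> l \<in> states D" for l
    by (auto simp: states_def \<psi>_def)
  have some: "(p, SOME q. q \<in> hat_equiv D `` {p}) \<in> hat_equiv D" if "p \<in> labels D" for p
  proof -
    have "p \<in> hat_equiv D `` {p}" using eqv that by (rule equiv_class_self)
    then have "(SOME q. q \<in> hat_equiv D `` {p}) \<in> hat_equiv D `` {p}" by (rule someI)
    then show ?thesis by simp
  qed
  have \<phi>\<psi>: "\<phi> (\<psi> l) = l" if "l \<in> C" for l
  proof
    fix p
    show "\<phi> (\<psi> l) p = l p"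
    proof (cases "p \<in> labels D")
      case True
      then show ?thesis using cls[OF True] const[OF that some[OF True]]
        by (simp add: \<phi>_def \<psi>_def)
    next
      case False
      then show ?thesis using that by (auto simp: \<phi>_def C_def PiE_iff extensional_def)
    qed
  qed
  have \<psi>\<phi>: "\<psi> (\<phi> s) = s" if s: "s \<in> states D" for s
  proof
    fix K
    show "\<psi> (\<phi> s) K = s K"
    proof (cases "K \<in> hat_components D")
      case True
      then obtain p where p: "p \<in> labels D" "K = hat_equiv D `` {p}"
        by (auto simp: hat_components_def elim: quotientE)
      define q where "q = (SOME q. q \<in> K)"
      have pq: "(p, q) \<in> hat_equiv D" using some[OF p(1)] p(2) by (simp add: q_def)
      then have q: "q \<in> labels D" "K = hat_equiv D `` {q}"
        using p(2) eqv by (auto simp: equiv_class_eq_iff)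
      then have "s K = of_bool (\<phi> s q)" using at[OF s q(1)] by (simp add: state_at_def)
      moreover have "\<psi> (\<phi> s) K = of_bool (\<phi> s q)" using True by (simp add: \<psi>_def q_def)
      ultimately show ?thesis by simp
    next
      case False
      then show ?thesis using that by (auto simp: \<psi>_def states_def PiE_iff extensional_def)
    qed
  qed
  have val: "(if legal D s then \<Prod>c\<leftarrow>filter is_crossing D. nu D x y z w s c else 0)
      = total_weight x y z w (\<phi> s) D" if s: "s \<in> states D" for s
  proof -
    have at': "state_at D s p = of_bool (\<phi> s p)" if "P \<in> set D" "p \<in> set_piece P" for P p
      using at[OF s, of p] that unfolding labels_def by blast
    have nu: "nu D x y z w s P = local_weight x y z w (\<phi> s) P"
      if P: "P \<in> set D" "is_crossing P" for P
    proof -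
      obtain a b c d where "P = Crossing a b c d" using P(2) by (cases P) auto
      then show ?thesis using at'[OF P(1)] by (simp add: nu_def)
    qed
    have one: "local_weight x y z w (\<phi> s) P = 1" if "P \<in> set D" "\<not> is_crossing P" for P
    proof -
      have "\<forall>p\<in>set_piece P. \<forall>q\<in>set_piece P. \<phi> s p = \<phi> s q"
        using \<phi>C[OF s] that unfolding C_def by blast
      then show ?thesis unfolding local_weight_non_crossing[OF that(2)] of_bool_def by (rule if_P)
    qed
    have "total_weight x y z w (\<phi> s) E = (\<Prod>c\<leftarrow>filter is_crossing E. nu D x y z w s c)"
      if "set E \<subseteq> set D" for E
      using that by (induction E) (auto simp: total_weight_def nu one)
    moreover have "total_weight x y z w (\<phi> s) D = 0" if illegal: "\<not> legal D s"
    proof -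
      obtain P where P: "P \<in> set D" "is_crossing P"
        "\<not> (\<forall>l\<in>{0, 1}. even (count_list (map (state_at D s) (ends P)) l))"
        using illegal unfolding legal_def by blast
      obtain a b c d where [simp]: "P = Crossing a b c d" using P(2) by (cases P) auto
      have "local_weight x y z w (\<phi> s) P = 0"
        using P(3) at'[OF P(1)] by (simp add: weight_illegal)
      then show ?thesis unfolding total_weight_def by (rule prod_list_zero_member[OF P(1)])
    qed
    ultimately show ?thesis by simp
  qed
  have "bracket D x y z w =
      (\<Sum>s\<in>states D. if legal D s then \<Prod>c\<leftarrow>filter is_crossing D. nu D x y z w s c else 0)"
  proof -
    have "finite (states D)" unfolding states_def hat_components_def
      by (intro finite_PiE finite_quotient) (auto simp: hat_equiv_def generated_equiv_def)
    then show ?thesis unfolding bracket_def by (simp add: sum.If_cases Int_def)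
  qed
  also have "\<dots> = (\<Sum>l\<in>C. total_weight x y z w l D)"
    by (rule sum.reindex_bij_witness[of _ \<psi> \<phi>]) (auto simp: \<phi>C \<psi>S \<phi>\<psi> \<psi>\<phi> val)
  also have "\<dots> = (\<Sum>l\<in>labels D \<rightarrow>\<^sub>E UNIV. total_weight x y z w l D)"
  proof (rule sum.mono_neutral_left)
    show "finite (labels D \<rightarrow>\<^sub>E (UNIV :: bool set))" by (intro finite_PiE) auto
    show "C \<subseteq> labels D \<rightarrow>\<^sub>E UNIV" by (auto simp: C_def)
    show "\<forall>l\<in>(labels D \<rightarrow>\<^sub>E UNIV) - C. total_weight x y z w l D = 0"
    proof
      fix l assume "l \<in> (labels D \<rightarrow>\<^sub>E (UNIV :: bool set)) - C"
      then obtain P where "P \<in> set D" "\<not> is_crossing P"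
          "\<not> (\<forall>p\<in>set_piece P. \<forall>q\<in>set_piece P. l p = l q)"
        unfolding C_def by blast
      then show "total_weight x y z w l D = 0" unfolding total_weight_def
        by (intro prod_list_zero_member[of P]) (simp_all add: local_weight_non_crossing)
    qed
  qed
  finally show ?thesis .
qed

section \<open>The bracket under recoding and local replacement\<close>

lemma set_concat_ends [simp]: "set (concat (map ends D)) = labels D"
proof -
  have "set (ends P) = set_piece P" for P :: "'a piece" by (cases P) auto
  then show ?thesis by (simp add: labels_def)
qed

lemma labels_map_piece [simp]: "labels (map (map_piece f) D) = f ` labels D"
  by (auto simp: labels_def piece.set_map)

lemma labels_mset_cong: "mset D = mset E \<Longrightarrow> labels D = labels E"
  unfolding labels_def by (drule mset_eq_setD) simp

definition end_count :: "'a piece list \<Rightarrow> 'a \<Rightarrow> nat" where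
  "end_count D p = count (mset (concat (map ends D))) p"

lemma end_count_append [simp]: "end_count (D @ E) p = end_count D p + end_count E p"
  by (simp add: end_count_def)

lemma end_count_eq_0_iff: "end_count D p = 0 \<longleftrightarrow> p \<notin> labels D"
  unfolding end_count_def count_eq_zero_iff set_mset_mset set_concat_ends ..

lemma closed_code_iff: "closed_code D \<longleftrightarrow> (\<forall>p\<in>labels D. end_count D p = 2)"
  by (simp add: closed_code_def end_count_def count_mset)

lemma local_weight_map_piece:
  "local_weight x y z w l (map_piece f P) = local_weight x y z w (l \<circ> f) P"
  by (cases P) auto

lemma total_weight_map_piece:
  "total_weight x y z w l (map (map_piece f) D) = total_weight x y z w (l \<circ> f) D"
  by (simp add: total_weight_def local_weight_map_piece o_def)

lemma bracket_cong:
  assumes "labels D = labels E" "\<And>l. total_weight x y z w l D = total_weight x y z w l E"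
  shows "bracket D x y z w = bracket E x y z w"
  using assms by (simp add: bracket_eq_contraction)

lemma bracket_permute:
  assumes "mset D = mset E"
  shows "bracket D x y z w = bracket E x y z w"
proof (rule bracket_cong[OF labels_mset_cong[OF assms]])
  show "total_weight x y z w l D = total_weight x y z w l E" for l
    using arg_cong[OF assms, of "\<lambda>M. \<Prod>P\<in>#M. local_weight x y z w l P"]
    by (simp add: total_weight_def prod_mset_prod_list flip: mset_map)
qed

text \<open>
  Precomposition with the renaming matches the colourings of the two codes.
\<close>

lemma bracket_rename:
  assumes "inj_on f (labels D)"
  shows "bracket (map (map_piece f) D) x y z w = bracket D x y z w"
  unfolding bracket_eq_contraction
proof (rule sum.reindex_bij_witness[of _ "\<lambda>m. \<lambda>q\<in>f ` labels D. m (inv_into (labels D) f q)"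
      "\<lambda>l. \<lambda>p\<in>labels D. l (f p)"])
  fix l :: "nat \<Rightarrow> bool"
  assume l: "l \<in> labels (map (map_piece f) D) \<rightarrow>\<^sub>E UNIV"
  show "(\<lambda>q\<in>f ` labels D. (\<lambda>p\<in>labels D. l (f p)) (inv_into (labels D) f q)) = l"
    using l by (fastforce simp: fun_eq_iff restrict_def PiE_iff extensional_def assms)
  show "total_weight x y z w (\<lambda>p\<in>labels D. l (f p)) D
      = total_weight x y z w l (map (map_piece f) D)"
    by (subst total_weight_map_piece, rule total_weight_cong) auto
next
  fix m :: "nat \<Rightarrow> bool"
  assume m: "m \<in> labels D \<rightarrow>\<^sub>E UNIV"
  show "(\<lambda>p\<in>labels D. (\<lambda>q\<in>f ` labels D. m (inv_into (labels D) f q)) (f p)) = m"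
    using m assms by (fastforce simp: fun_eq_iff restrict_def PiE_iff extensional_def)
qed (auto simp: PiE_iff)

text \<open>
  Summation over the colour of a single label.  Iterated over the interior labels of a disk it
  yields the function of the boundary colours by which the disk enters the bracket.
\<close>

definition sum_out :: "'a \<Rightarrow> (('a \<Rightarrow> bool) \<Rightarrow> 'r::comm_ring_1) \<Rightarrow> ('a \<Rightarrow> bool) \<Rightarrow> 'r" where
  "sum_out p F l = F (l(p := True)) + F (l(p := False))"

lemma sum_PiE_insert:
  assumes "p \<notin> V"
  shows "(\<Sum>l\<in>insert p V \<rightarrow>\<^sub>E UNIV. F l) = (\<Sum>l\<in>V \<rightarrow>\<^sub>E UNIV. sum_out p F l)"
proof -
  have "(\<Sum>l\<in>insert p V \<rightarrow>\<^sub>E UNIV. F l) =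
      (\<Sum>(v, l)\<in>UNIV \<times> (V \<rightarrow>\<^sub>E UNIV). F (l(p := v)))"
    unfolding PiE_insert_eq using inj_combinator[OF assms, of "\<lambda>_. UNIV"]
    by (subst sum.reindex) (auto simp: case_prod_unfold)
  also have "\<dots> = (\<Sum>v\<in>UNIV. \<Sum>l\<in>V \<rightarrow>\<^sub>E UNIV. F (l(p := v)))"
    by (simp add: sum.cartesian_product)
  finally show ?thesis by (simp add: UNIV_bool sum_out_def sum.distrib add.commute)
qed

lemma sum_PiE_fold_sum_out:
  assumes "distinct js" "set js \<inter> V = {}"
  shows "(\<Sum>l\<in>set js \<union> V \<rightarrow>\<^sub>E UNIV. F l) = (\<Sum>l\<in>V \<rightarrow>\<^sub>E UNIV. fold sum_out js F l)"
  using assms by (induction js arbitrary: F) (simp_all add: sum_PiE_insert)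

lemma fold_sum_out_mult:
  assumes "\<And>p l v. p \<in> set js \<Longrightarrow> H (l(p := v)) = H l"
  shows "fold sum_out js (\<lambda>l. G l * H l) = (\<lambda>l. fold sum_out js G l * H l)"
  using assms
proof (induction js arbitrary: G)
  case (Cons p js)
  have "sum_out p (\<lambda>l. G l * H l) = (\<lambda>l. sum_out p G l * H l)"
    using Cons.prems by (simp add: sum_out_def distrib_right fun_eq_iff del: fun_upd_apply)
  then show ?case using Cons by simp
qed simp

text \<open>
  The boundary points \<open>bs\<close> of a disk are listed with multiplicity, because two of them may carry
  the same label; an interior label, in \<open>js\<close>, is the end of two strands in the disk.
\<close>

definition has_interface :: "'a piece list \<Rightarrow> 'a list \<Rightarrow> 'a list \<Rightarrow> bool" where
  "has_interface T bs js \<longleftrightarrow> mset (concat (map ends T)) = mset bs + mset js + mset js"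

lemma has_interface_labels: "has_interface T bs js \<Longrightarrow> labels T = set bs \<union> set js"
  unfolding has_interface_def
  by (drule arg_cong[of _ _ set_mset]) (simp only: set_mset_mset set_mset_union set_concat_ends, blast)

text \<open>
  In a closed code an interior label has its two occurrences inside the disk, which leaves none for
  the boundary or the outside.
\<close>

lemma has_interface_fresh:
  assumes "has_interface T bs js" "closed_code (T @ S)"
  shows "distinct js" "set js \<inter> set bs = {}" "set js \<inter> labels S = {}"
proof -
  have *: "count (mset js) p = 1 \<and> count (mset bs) p = 0 \<and> end_count S p = 0" if "p \<in> set js" for p
  proof -
    have "p \<in> labels (T @ S)" using that has_interface_labels[OF assms(1)] by simp
    then have "end_count T p + end_count S p = 2"
      using assms(2) by (simp add: closed_code_iff)
    moreover have "end_count T p = count (mset bs) p + 2 * count (mset js) p"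
      using assms(1) by (simp add: has_interface_def end_count_def)
    moreover have "count (mset js) p > 0" using that by simp
    ultimately show ?thesis by linarith
  qed
  then show "distinct js"
    by (simp add: distinct_count_atmost_1)
  show "set js \<inter> set bs = {}" using * by auto
  show "set js \<inter> labels S = {}" using * by (auto simp: end_count_eq_0_iff)
qed

text \<open>
  The factors of the outside do not involve the interior labels and can be pulled out of the sums
  over their colours.
\<close>

lemma bracket_replace:
  assumes "closed_code (T @ S)" "closed_code (T' @ S)"
    and "has_interface T bs js" "has_interface T' bs js'"
    and local: "\<And>l. fold sum_out js (\<lambda>l. total_weight x y z w l T) l
      = c * fold sum_out js' (\<lambda>l. total_weight x y z w l T') l"
  shows "bracket (T @ S) x y z w = c * bracket (T' @ S) x y z w"
proof -
  have split: "bracket (U @ S) x y z w = (\<Sum>l\<in>set bs \<union> labels S \<rightarrow>\<^sub>E UNIV.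
      fold sum_out is (\<lambda>l. total_weight x y z w l U) l * total_weight x y z w l S)"
    if "closed_code (U @ S)" "has_interface U bs is" for U "is"
  proof -
    note fresh = has_interface_fresh[OF that(2,1)]
    have "labels (U @ S) = set is \<union> (set bs \<union> labels S)"
      using has_interface_labels[OF that(2)] by auto
    moreover have "set is \<inter> (set bs \<union> labels S) = {}" using fresh by auto
    moreover have "total_weight x y z w (l(p := v)) S = total_weight x y z w l S"
      if "p \<in> set is" for p l v
      using that fresh(3) by (intro total_weight_cong) auto
    ultimately show ?thesis
      by (simp add: bracket_eq_contraction sum_PiE_fold_sum_out[OF fresh(1)] fold_sum_out_mult)
  qed
  show ?thesis
    using assms by (simp add: split local sum_distrib_left mult.assoc)
qed

text \<open>
  The factor of the arc from \<open>p\<close> to \<open>q\<close> forces \<open>q\<close> to have the colour of \<open>p\<close>, and summing over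
  the colour of \<open>q\<close> performs the substitution.
\<close>

lemma bracket_remove_point:
  assumes closed: "closed_code (Arc p q # D)" and "p \<noteq> q"
  shows "bracket (Arc p q # D) x y z w = bracket (map (map_piece (id(q := p))) D) x y z w"
proof -
  have "end_count D p = 1" "end_count D q = 1"
    using closed \<open>p \<noteq> q\<close> by (auto simp: closed_code_iff end_count_def)
  then have pq: "p \<in> labels D" "q \<in> labels D"
    by (metis end_count_eq_0_iff zero_neq_one)+
  define V where "V = labels D - {q}"
  have V: "labels (Arc p q # D) = insert q V" "id(q := p) ` labels D = V" "q \<notin> V"
    using pq \<open>p \<noteq> q\<close> by (auto simp: V_def)
  have "sum_out q (\<lambda>l. total_weight x y z w l (Arc p q # D)) l
      = total_weight x y z w l (map (map_piece (id(q := p))) D)" for l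
  proof -
    have "l \<circ> id(q := p) = l(q := l p)" by (simp add: fun_eq_iff)
    then show ?thesis using \<open>p \<noteq> q\<close>
      by (cases "l p") (simp_all add: sum_out_def total_weight_map_piece, simp_all add: total_weight_def)
  qed
  then show ?thesis
    by (simp only: bracket_eq_contraction V labels_map_piece sum_PiE_insert[OF V(3)])
qed

lemma weight_half_turn: "weight x y z w d c b a = weight x y z w a b c d"
  by (auto simp: weight_def)

lemma bracket_recode:
  assumes "recode D E" "closed_code D"
  shows "bracket D x y z w = bracket E x y z w"
  using assms
proof (induction rule: recode.induct)
  case (permute D E)
  from permute(1) show ?case by (rule bracket_permute)
next
  case (rename f D)
  then show ?case by (simp add: bracket_rename)
next
  case (flip_arc p q D)
  show ?case by (rule bracket_cong) (auto simp: total_weight_def eq_commute)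
next
  case (turn_crossing a b c d D)
  show ?case by (rule bracket_cong) (auto simp: total_weight_def weight_half_turn)
next
  case (turn_vertex a b c d D)
  show ?case by (rule bracket_cong) (auto simp: total_weight_def of_bool_def)
next
  case (remove_point p q D)
  then show ?case by (intro bracket_remove_point)
qed

section \<open>Strands, orientations and the self-writhe\<close>

fun strands :: "'a piece \<Rightarrow> ('a \<times> 'a) list" where
  "strands (Arc p q) = [(p, q)]"
| "strands (Crossing a b c d) = [(b, c), (a, d)]"
| "strands (Vertex a b c d) = [(b, c), (a, d)]"

definition strand_invariant :: "('a \<Rightarrow> 'c) \<Rightarrow> 'a piece list \<Rightarrow> bool" where
  "strand_invariant g L \<longleftrightarrow> (\<forall>P\<in>set L. \<forall>(p, q)\<in>set (strands P). g p = g q)"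

lemma strand_invariant_Nil [simp]: "strand_invariant g []"
  by (simp add: strand_invariant_def)

lemma strand_invariant_Cons [simp]:
  "strand_invariant g (P # L) \<longleftrightarrow> (\<forall>(p, q)\<in>set (strands P). g p = g q) \<and> strand_invariant g L"
  by (simp add: strand_invariant_def)

lemma strand_invariant_append [simp]:
  "strand_invariant g (L @ M) \<longleftrightarrow> strand_invariant g L \<and> strand_invariant g M"
  by (auto simp: strand_invariant_def)

lemma strand_invariant_map_piece:
  "strand_invariant g (map (map_piece f) L) \<longleftrightarrow> strand_invariant (g \<circ> f) L"
proof -
  have "(\<forall>(p, q)\<in>set (strands (map_piece f P)). g p = g q) \<longleftrightarrow>
      (\<forall>(p, q)\<in>set (strands P). (g \<circ> f) p = (g \<circ> f) q)" for P
    by (cases P) auto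
  then show ?thesis by (simp add: strand_invariant_def)
qed

lemma strand_invariant_cong:
  assumes "\<And>p. p \<in> labels L \<Longrightarrow> g p = h p"
  shows "strand_invariant g L \<longleftrightarrow> strand_invariant h L"
proof -
  have "(\<forall>(p, q)\<in>set (strands P). g p = g q) \<longleftrightarrow> (\<forall>(p, q)\<in>set (strands P). h p = h q)"
    if "P \<in> set L" for P
  proof -
    have "g p = h p" if "p \<in> set_piece P" for p
      using that \<open>P \<in> set L\<close> assms unfolding labels_def by blast
    then show ?thesis by (cases P) simp_all
  qed
  then show ?thesis by (simp add: strand_invariant_def)
qed

text \<open>
  A name for the component through \<open>p\<close>.  Being the set of all invariants that hold at \<open>p\<close>, it
  requires no choice and equals the name of another label exactly if no invariant tells them apart.
\<close>

definition strand_class :: "'a piece list \<Rightarrow> 'a \<Rightarrow> ('a \<Rightarrow> bool) set" where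
  "strand_class L p = {g. strand_invariant g L \<and> g p}"

lemma strand_class_eq_iff:
  "strand_class L p = strand_class L q \<longleftrightarrow>
     (\<forall>g :: 'a \<Rightarrow> bool. strand_invariant g L \<longrightarrow> g p = g q)"
  by (auto simp: strand_class_def)

lemma strand_invariant_strand_class: "strand_invariant (strand_class L) L"
  by (auto simp: strand_invariant_def strand_class_def)

text \<open>
  The two ends of a strand are half a turn apart in the cyclic list of the ends of its piece.
\<close>

lemma opposite_invariant_iff:
  "(\<forall>k<length (ends P). g (ends P ! k) =
       g (ends P ! ((k + length (ends P) div 2) mod length (ends P)))) \<longleftrightarrow>
   (\<forall>(p, q)\<in>set (strands P). g p = g q)"
  by (cases P) (auto simp: All_less_Suc)

lemma link_components_eq:
  fixes L :: diagram
  shows "link_components L =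
     labels L // {(p, q). p \<in> labels L \<and> q \<in> labels L \<and> strand_class L p = strand_class L q}"
proof -
  let ?R = "{(dart_label L d, dart_label L (opposite_dart L d)) | d. d \<in> darts L}"
  have "(\<forall>(p, q)\<in>?R. g p = g q) \<longleftrightarrow> strand_invariant g L" for g :: "nat \<Rightarrow> bool"
  proof -
    have "(\<forall>(p, q)\<in>?R. g p = g q) \<longleftrightarrow> (\<forall>i<length L. \<forall>k<length (ends (L ! i)).
        g (ends (L ! i) ! k) =
        g (ends (L ! i) ! ((k + length (ends (L ! i)) div 2) mod length (ends (L ! i)))))"
      by (fastforce simp: darts_def)
    also have "\<dots> \<longleftrightarrow> strand_invariant g L"
      unfolding strand_invariant_def opposite_invariant_iff by (simp add: all_set_conv_all_nth)
    finally show ?thesis .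
  qed
  then have "generated_equiv (labels L) ?R =
      {(p, q). p \<in> labels L \<and> q \<in> labels L \<and> strand_class L p = strand_class L q}"
    by (auto simp: generated_equiv_iff_invariants strand_class_eq_iff)
  then show ?thesis by (simp add: link_components_def)
qed

text \<open>
  One unit of flow through a strand with ends \<open>p\<close> and \<open>q\<close>, counted as it leaves the piece: the
  strand leaves at \<open>p\<close> if \<open>u\<close> holds, and at \<open>q\<close> otherwise.
\<close>

definition unit_flow :: "bool \<Rightarrow> 'a \<Rightarrow> 'a \<Rightarrow> 'a \<Rightarrow> int" where
  "unit_flow u p q x = (if u then 1 else - 1) * (of_bool (x = p) - of_bool (x = q))"

text \<open>
  An oriented piece \<open>(P, u, v)\<close> directs the strand through the NE arm by \<open>u\<close> and the strand through
  the NW arm by \<open>v\<close>; an arc is directed by \<open>u\<close>.  Lists of oriented pieces do not refer to positions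
  in the code, so they can be cut, permuted and renamed together with it.
\<close>

fun outflow :: "'a piece \<times> bool \<times> bool \<Rightarrow> 'a \<Rightarrow> int" where
  "outflow (Arc p q, u, v) x = unit_flow u p q x"
| "outflow (Crossing a b c d, u, v) x = unit_flow u b c x + unit_flow v a d x"
| "outflow (Vertex a b c d, u, v) x = unit_flow u b c x + unit_flow v a d x"

definition total_outflow :: "('a piece \<times> bool \<times> bool) list \<Rightarrow> 'a \<Rightarrow> int" where
  "total_outflow OL x = (\<Sum>X\<leftarrow>OL. outflow X x)"

lemma total_outflow_simps [simp]:
  "total_outflow [] x = 0"
  "total_outflow (X # OL) x = outflow X x + total_outflow OL x"
  "total_outflow (OL @ OM) x = total_outflow OL x + total_outflow OM x"
  by (simp_all add: total_outflow_def)

text \<open>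
  Kirchhoff's law.  In a closed code every label has two ends, so the law says that the curve
  enters one piece there and leaves another.
\<close>

definition balanced :: "('a piece \<times> bool \<times> bool) list \<Rightarrow> bool" where
  "balanced OL \<longleftrightarrow> (\<forall>x. total_outflow OL x = 0)"

text \<open>
  The second half of the list of ends is opposite to the first half and has the other directions.
\<close>

fun leaves :: "'a piece \<times> bool \<times> bool \<Rightarrow> nat \<Rightarrow> bool" where
  "leaves (P, u, v) k =
     (if k = 0 then u else if k = length (ends P) div 2 then \<not> u else if k = 1 then v else \<not> v)"

lemma outflow_eq_sum_ends:
  "outflow (P, u, v) x =
     (\<Sum>k<length (ends P). of_bool (ends P ! k = x) * (if leaves (P, u, v) k then 1 else - 1))"
  by (cases P) (simp_all add: unit_flow_def eq_commute)

lemma darts_eq_Sigma: "darts L = (SIGMA i:{..<length L}. {..<length (ends (L ! i))})"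
  by (auto simp: darts_def)

lemma finite_darts: "finite (darts L)"
  by (simp add: darts_eq_Sigma)

lemma sum_darts: "(\<Sum>d\<in>darts L. f d) = (\<Sum>i<length L. \<Sum>k<length (ends (L ! i)). f (i, k))"
  by (simp add: darts_eq_Sigma sum.Sigma)

lemma end_count_eq_card: "end_count L x = card {d \<in> darts L. dart_label L d = x}"
proof -
  have count: "count (mset es) x = (\<Sum>k<length es. of_bool (es ! k = x))" for es :: "'a list"
    by (induction es) (auto simp: sum.lessThan_Suc_shift simp del: sum.lessThan_Suc)
  have "end_count L x = (\<Sum>P\<leftarrow>L. count (mset (ends P)) x)"
    by (induction L) (auto simp: end_count_def)
  also have "\<dots> = (\<Sum>i<length L. count (mset (ends (L ! i))) x)"
    by (simp add: sum_list_sum_nth atLeast0LessThan)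
  also have "\<dots> = (\<Sum>d\<in>darts L. of_bool (dart_label L d = x))"
    by (simp add: count sum_darts)
  also have "\<dots> = card {d \<in> darts L. dart_label L d = x}"
    using finite_darts[of L] by (simp add: of_bool_def sum.If_cases Int_def)
  finally show ?thesis .
qed

text \<open>
  The outflow at a label is the sum of the signs of its two darts; if it vanishes, one dart is
  outgoing and the other incoming.
\<close>

lemma orientation_of_balanced:
  assumes "closed_code (map fst OL)" "balanced OL"
  shows "orientation (map fst OL) (\<lambda>(i, k). leaves (OL ! i) k)"
proof -
  define L where "L = map fst OL"
  define out where "out = (\<lambda>(i, k). leaves (OL ! i) k)"
  have "out (opposite_dart L d) \<noteq> out d" if "d \<in> darts L" for d
  proof -
    obtain i k where d: "d = (i, k)" "i < length OL" "k < length (ends (L ! i))"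
      using \<open>d \<in> darts L\<close> by (auto simp: darts_def L_def)
    obtain P u v where P: "OL ! i = (P, u, v)" by (metis prod_cases3)
    then have "L ! i = P" using d by (simp add: L_def)
    then show ?thesis using d P
      by (cases P) (auto simp: out_def less_Suc_eq)
  qed
  moreover have "out d' \<noteq> out d" if "(d, d') \<in> glued L" for d d'
  proof -
    define x where "x = dart_label L d"
    let ?A = "{e \<in> darts L. dart_label L e = x}"
    have dd: "d \<in> ?A" "d' \<in> ?A" "d \<noteq> d'" using that by (auto simp: glued_def x_def)
    then have "end_count L x \<noteq> 0"
      unfolding end_count_eq_card using finite_darts[of L] card_gt_0_iff[of ?A] by fastforce
    then have "card ?A = 2"
      using assms(1) by (simp add: closed_code_iff end_count_eq_0_iff L_def flip: end_count_eq_card)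
    then have A: "?A = {d, d'}"
      using dd card_subset_eq[of ?A "{d, d'}"] finite_darts[of L] by simp
    have "0 = total_outflow OL x" using assms(2) by (simp add: balanced_def)
    also have "\<dots> = (\<Sum>i<length OL. outflow (OL ! i) x)"
      by (simp add: total_outflow_def sum_list_sum_nth atLeast0LessThan)
    also have "\<dots> = (\<Sum>i<length L. \<Sum>k<length (ends (L ! i)).
        of_bool (ends (L ! i) ! k = x) * (if leaves (OL ! i) k then 1 else - 1))"
      using outflow_eq_sum_ends[of "fst (OL ! i)" "fst (snd (OL ! i))" "snd (snd (OL ! i))" x for i]
      by (intro sum.cong) (auto simp: L_def simp del: leaves.simps)
    also have "\<dots> = (\<Sum>e\<in>darts L. of_bool (dart_label L e = x) * (if out e then 1 else - 1))"
      by (simp add: sum_darts out_def)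
    also have "\<dots> = (\<Sum>e\<in>?A. if out e then 1 else - 1)"
      by (rule sum.mono_neutral_cong_right) (auto simp: finite_darts)
    finally show ?thesis using dd(3) unfolding A by (auto split: if_splits)
  qed
  ultimately show ?thesis unfolding orientation_def L_def[symmetric] out_def[symmetric] by blast
qed

text \<open>
  Passing to the other end of a strand, or through a gluing, reverses both orientations.  Whether
  they agree is therefore constant along a component.
\<close>

lemma orientations_agree:
  assumes "orientation L out" "orientation L out'" "d \<in> darts L" "d' \<in> darts L"
    and joined: "strand_class L (dart_label L d) = strand_class L (dart_label L d')"
  shows "(out d = out' d) = (out d' = out' d')"
proof -
  define g where "g p \<longleftrightarrow> (\<exists>e\<in>darts L. dart_label L e = p \<and> out e = out' e)" for p
  have g: "g (dart_label L e) \<longleftrightarrow> out e = out' e" if "e \<in> darts L" for e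
  proof -
    have "(out e = out' e) = (out f = out' f)"
      if "f \<in> darts L" "dart_label L f = dart_label L e" for f
    proof (cases "e = f")
      case False
      then have "(e, f) \<in> glued L" using that \<open>e \<in> darts L\<close> by (simp add: glued_def)
      then show ?thesis using assms(1,2) unfolding orientation_def by fastforce
    qed simp
    then show ?thesis using \<open>e \<in> darts L\<close> unfolding g_def by blast
  qed
  have opp: "g (dart_label L (opposite_dart L e)) = g (dart_label L e)" if "e \<in> darts L" for e
  proof -
    have "opposite_dart L e \<in> darts L"
      using that by (cases e) (auto simp: darts_def intro!: mod_less_divisor)
    then show ?thesis using g that assms(1,2) unfolding orientation_def by blast
  qed
  have "strand_invariant g L"
    unfolding strand_invariant_def
  proof
    fix P assume "P \<in> set L"
    then obtain i where i: "i < length L" "P = L ! i" by (auto simp: in_set_conv_nth)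
    have "\<forall>k<length (ends P). g (ends P ! k) =
       g (ends P ! ((k + length (ends P) div 2) mod length (ends P)))"
      using opp[of "(i, k)" for k] i by (simp add: darts_def)
    then show "\<forall>(p, q)\<in>set (strands P). g p = g q" by (simp only: opposite_invariant_iff)
  qed
  then have "g (dart_label L d) = g (dart_label L d')"
    using joined unfolding strand_class_eq_iff by blast
  then show ?thesis using g assms(3,4) by simp
qed

text \<open>
  \<open>\<kappa>\<close> names the component of each label.  A crossing is a self-crossing if its NE and NW arms,
  which belong to different strands, lie on the same component.
\<close>

fun self_sign :: "('a \<Rightarrow> 'c) \<Rightarrow> 'a piece \<times> bool \<times> bool \<Rightarrow> int" where
  "self_sign \<kappa> (P, u, v) =
     (if is_crossing P \<and> \<kappa> (ne P) = \<kappa> (nw P) then if u = v then 1 else - 1 else 0)"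

definition total_self_sign :: "('a \<Rightarrow> 'c) \<Rightarrow> ('a piece \<times> bool \<times> bool) list \<Rightarrow> int" where
  "total_self_sign \<kappa> OL = (\<Sum>X\<leftarrow>OL. self_sign \<kappa> X)"

lemma total_self_sign_simps [simp]:
  "total_self_sign \<kappa> [] = 0"
  "total_self_sign \<kappa> (X # OL) = self_sign \<kappa> X + total_self_sign \<kappa> OL"
  "total_self_sign \<kappa> (OL @ OM) = total_self_sign \<kappa> OL + total_self_sign \<kappa> OM"
  by (simp_all add: total_self_sign_def)

text \<open>
  The components are disjoint, so a crossing is counted for at most one of them.
\<close>

lemma self_writhe_eq_sum_crossings:
  "self_writhe L = (\<Sum>i | i < length L \<and> is_crossing (L ! i).
     if strand_class L (ne (L ! i)) = strand_class L (nw (L ! i))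
     then crossing_sign (SOME out. orientation L out) i else 0)"
proof -
  define r where "r = {(p, q). p \<in> labels L \<and> q \<in> labels L \<and> strand_class L p = strand_class L q}"
  have r: "equiv (labels L) r"
    by (auto simp: r_def equiv_def refl_on_def sym_def trans_def)
  have comps: "link_components L = labels L // r"
    by (simp add: link_components_eq r_def)
  have fin: "finite (link_components L)" unfolding comps
    by (rule finite_quotient) (auto simp: r_def)
  let ?f = "crossing_sign (SOME out. orientation L out)"
  let ?A = "{i. i < length L \<and> is_crossing (L ! i)}"
  have sel: "{K \<in> link_components L. set_piece (L ! i) \<subseteq> K} =
     (if strand_class L (ne (L ! i)) = strand_class L (nw (L ! i)) then {r `` {ne (L ! i)}} else {})"
    if i: "i \<in> ?A" for i
  proof -
    obtain a b c d where P: "L ! i = Crossing a b c d"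
      using i by (cases "L ! i") auto
    have mem: "L ! i \<in> set L" using i by simp
    then have lab: "{a, b, c, d} \<subseteq> labels L" unfolding labels_def using P by force
    have strand: "strand_class L b = strand_class L c" "strand_class L a = strand_class L d"
      using strand_invariant_strand_class[of L] mem P unfolding strand_invariant_def by fastforce+
    have "K = r `` {b}" if "K \<in> link_components L" "b \<in> K" for K
      using that r unfolding comps by (metis quotientE Image_singleton_iff equiv_class_eq)
    moreover have "r `` {b} \<in> link_components L" using lab unfolding comps by (simp add: quotientI)
    moreover have "{a, b, c, d} \<subseteq> r `` {b} \<longleftrightarrow> strand_class L b = strand_class L a"
      using lab strand by (auto simp: r_def)
    ultimately show ?thesis using P by auto
  qed
  have "self_writhe L = (\<Sum>K\<in>link_components L. \<Sum>i | i \<in> ?A \<and> set_piece (L ! i) \<subseteq> K. ?f i)"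
    by (simp add: self_writhe_def component_writhe_def conj_assoc)
  also have "\<dots> = (\<Sum>i\<in>?A. \<Sum>K | K \<in> link_components L \<and> set_piece (L ! i) \<subseteq> K. ?f i)"
    by (rule sum.swap_restrict[OF fin]) simp
  also have "\<dots> = (\<Sum>i\<in>?A. if strand_class L (ne (L ! i)) = strand_class L (nw (L ! i)) then ?f i else 0)"
    using sel by (intro sum.cong refl) simp
  finally show ?thesis .
qed

text \<open>
  Reversing a component reverses both strands of its self-crossings and preserves their signs.
  Hence the chosen orientation may be replaced by any other.
\<close>

lemma self_writhe_eq_total_self_sign:
  fixes OL :: "(nat piece \<times> bool \<times> bool) list"
  assumes "closed_code (map fst OL)" "balanced OL"
  shows "self_writhe (map fst OL) = total_self_sign (strand_class (map fst OL)) OL"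
proof -
  define L where "L = map fst OL"
  define out where "out = (\<lambda>(i, k). leaves (OL ! i) k)"
  have out: "orientation L out"
    unfolding L_def out_def by (rule orientation_of_balanced[OF assms])
  define out' where "out' = (SOME out. orientation L out)"
  have out': "orientation L out'" unfolding out'_def by (rule someI[of "orientation L"]) (rule out)
  have sign: "(if strand_class L (ne (L ! i)) = strand_class L (nw (L ! i))
      then crossing_sign out' i else 0) = self_sign (strand_class L) (OL ! i)"
    if i: "i < length L" "is_crossing (L ! i)" for i
  proof -
    obtain P u v where OLi: "OL ! i = (P, u, v)" by (metis prod_cases3)
    then have P: "L ! i = P" using i by (simp add: L_def)
    then obtain a b c d where [simp]: "P = Crossing a b c d" using i by (cases P) auto
    have "(out (i, 0) = out' (i, 0)) = (out (i, 1) = out' (i, 1))"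
      if "strand_class L b = strand_class L a"
      by (rule orientations_agree[OF out out']) (use i P that in \<open>auto simp: darts_def\<close>)
    moreover have "out (i, 0) = u" "out (i, 1) = v" using OLi by (simp_all add: out_def)
    ultimately show ?thesis using P OLi by (auto simp: crossing_sign_def)
  qed
  have "self_writhe L = (\<Sum>i | i < length L \<and> is_crossing (L ! i). self_sign (strand_class L) (OL ! i))"
    unfolding self_writhe_eq_sum_crossings out'_def[symmetric] using sign by (intro sum.cong) auto
  also have "\<dots> = (\<Sum>i<length L. self_sign (strand_class L) (OL ! i))"
  proof (rule sum.mono_neutral_left)
    have "self_sign (strand_class L) X = 0" if "\<not> is_crossing (fst X)" for X
      using that by (cases X) auto
    then show "\<forall>i\<in>{..<length L} - {i. i < length L \<and> is_crossing (L ! i)}.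
        self_sign (strand_class L) (OL ! i) = 0" by (simp add: L_def)
  qed auto
  also have "\<dots> = total_self_sign (strand_class L) OL"
    by (simp add: total_self_sign_def sum_list_sum_nth atLeast0LessThan L_def)
  finally show ?thesis by (simp add: L_def)
qed

section \<open>Existence of orientations\<close>

definition degree :: "('a \<times> 'a) multiset \<Rightarrow> 'a \<Rightarrow> nat" where
  "degree M x = (\<Sum>(p, q)\<in>#M. of_bool (x = p) + of_bool (x = q))"

lemma degree_simps [simp]:
  "degree {#} x = 0"
  "degree (add_mset (p, q) M) x = of_bool (x = p) + of_bool (x = q) + degree M x"
  by (simp_all add: degree_def)

lemma degree_nonzero: "degree M x \<noteq> 0 \<Longrightarrow> \<exists>e\<in>#M. x = fst e \<or> x = snd e"
proof (induction M)
  case (add e M)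
  then show ?case by (cases e) (auto split: if_splits)
qed simp

definition net_flow :: "(('a \<times> 'a) \<times> bool) multiset \<Rightarrow> 'a \<Rightarrow> int" where
  "net_flow N x = (\<Sum>((p, q), u)\<in>#N. unit_flow u p q x)"

lemma net_flow_simps [simp]:
  "net_flow {#} x = 0"
  "net_flow (add_mset ((p, q), u) N) x = unit_flow u p q x + net_flow N x"
  by (simp_all add: net_flow_def)

text \<open>
  A graph with even degrees has an orientation with equal in- and outdegrees: replace an edge
  \<open>(p, q)\<close> and another edge between \<open>q\<close> and \<open>r\<close> by a single edge \<open>(p, r)\<close>, orient the smaller graph,
  and let the two edges follow the direction of the one that replaced them.
\<close>

lemma eulerian_orientation:
  assumes "\<forall>x. even (degree M x)"
  shows "\<exists>N. image_mset fst N = M \<and> (\<forall>x. net_flow N x = 0)"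
  using assms
proof (induction "size M" arbitrary: M rule: less_induct)
  case less
  show ?case
  proof (cases M)
    case empty
    then show ?thesis by (intro exI[of _ "{#}"]) simp
  next
    case (add e M1)
    obtain p q where e: "e = (p, q)" by force
    show ?thesis
    proof (cases "p = q")
      case True
      have "even (degree M1 x)" for x
        using less.prems[rule_format, of x] True by (auto simp: add e split: if_splits)
      then obtain N where "image_mset fst N = M1" "\<forall>x. net_flow N x = 0"
        using less.hyps[of M1] add by auto
      then show ?thesis using True
        by (intro exI[of _ "add_mset ((p, q), True) N"]) (simp add: add e unit_flow_def)
    next
      case False
      have "odd (degree M1 q)" using less.prems[rule_format, of q] False by (auto simp: add e)
      then have "degree M1 q \<noteq> 0" by (metis even_zero)
      from degree_nonzero[OF this] obtain f where f: "f \<in># M1" "q = fst f \<or> q = snd f"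
        by blast
      then obtain r b where r: "f = (if b then (q, r) else (r, q))"
        by (metis prod.collapse)
      obtain M2 where M2: "M1 = add_mset f M2" using f(1) by (metis mset_add)
      have "even (degree (add_mset (p, r) M2) x)" for x
        using less.prems[rule_format, of x]
        by (auto simp: add e M2 r of_bool_def split: if_splits)
      then obtain N where N: "image_mset fst N = add_mset (p, r) M2" "\<forall>x. net_flow N x = 0"
        using less.hyps[of "add_mset (p, r) M2"] add M2 by auto
      obtain N' g where "N = add_mset g N'" "fst g = (p, r)" and N'2: "image_mset fst N' = M2"
        using msed_map_invR[OF N(1)] by blast
      then obtain u where N': "N = add_mset ((p, r), u) N'" "image_mset fst N' = M2"
        by (cases g) simp
      have "net_flow (add_mset ((p, q), u) (add_mset (f, u = b) N')) x = net_flow N x" for x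
        by (auto simp: N' r unit_flow_def)
      then show ?thesis using N(2) N'(2)
        by (intro exI[of _ "add_mset ((p, q), u) (add_mset (f, u = b) N')"]) (simp add: add e M2)
    qed
  qed
qed

text \<open>
  A reordering of the values lifts to a reordering of the arguments.  It transports orientations
  between codes that differ in the order of the pieces.
\<close>

lemma image_mset_eq_mset_lift:
  "image_mset f M = mset xs \<Longrightarrow> \<exists>ys. mset ys = M \<and> map f ys = xs"
proof (induction xs arbitrary: M)
  case (Cons x xs)
  then obtain y M' where "M = add_mset y M'" "f y = x" "image_mset f M' = mset xs"
    by (metis mset.simps(2) msed_map_invR)
  then show ?case using Cons.IH[of M'] by (metis list.simps(9) mset.simps(2))
qed simp

lemma oriented_code_of_strands:
  assumes "map fst ds = concat (map strands L)"
  shows "\<exists>OL. map fst OL = L \<and> (\<forall>x. total_outflow OL x = net_flow (mset ds) x)"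
  using assms
proof (induction L arbitrary: ds)
  case (Cons P L)
  obtain ds1 ds2 where ds: "ds = ds1 @ ds2" "map fst ds1 = strands P"
      "map fst ds2 = concat (map strands L)"
    using Cons.prems by (auto simp: map_eq_append_conv)
  obtain OL where OL: "map fst OL = L" "\<forall>x. total_outflow OL x = net_flow (mset ds2) x"
    using Cons.IH[OF ds(3)] by blast
  obtain u v where uv: "outflow (P, u, v) x = net_flow (mset ds1) x" for x
  proof (cases P)
    case (Arc p q)
    then obtain u where "ds1 = [((p, q), u)]" using ds(2) by (auto simp: map_eq_Cons_conv)
    then show ?thesis using that[of u True] Arc by simp
  next
    case (Crossing a b c d)
    then obtain u v where "ds1 = [((b, c), u), ((a, d), v)]"
      using ds(2) by (auto simp: map_eq_Cons_conv)
    then show ?thesis using that[of u v] Crossing by simp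
  next
    case (Vertex a b c d)
    then obtain u v where "ds1 = [((b, c), u), ((a, d), v)]"
      using ds(2) by (auto simp: map_eq_Cons_conv)
    then show ?thesis using that[of u v] Vertex by simp
  qed
  have "net_flow (mset ds) x = net_flow (mset ds1) x + net_flow (mset ds2) x" for x
    by (simp add: ds(1) net_flow_def)
  then show ?case using OL uv by (intro exI[of _ "(P, u, v) # OL"]) simp
qed (auto intro: exI[of _ "[]"])

text \<open>
  The strands of a closed code form a graph on the labels in which all degrees are \<open>2\<close>.
\<close>

lemma balanced_orientation_exists:
  assumes "closed_code L"
  obtains OL where "map fst OL = L" "balanced OL"
proof -
  have deg: "degree (mset (concat (map strands L))) x = end_count L x" for x
  proof -
    have "degree (mset (strands P)) x = count (mset (ends P)) x" for P
      by (cases P) auto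
    then show ?thesis by (induction L) (auto simp: end_count_def degree_def)
  qed
  have "even (end_count L x)" for x
  proof (cases "x \<in> labels L")
    case True
    then show ?thesis using assms by (simp add: closed_code_iff)
  next
    case False
    then have "end_count L x = 0" by (simp add: end_count_eq_0_iff)
    then show ?thesis by simp
  qed
  then obtain N where N: "image_mset fst N = mset (concat (map strands L))" "\<forall>x. net_flow N x = 0"
    using eulerian_orientation[of "mset (concat (map strands L))"] deg by auto
  obtain ds where "mset ds = N" "map fst ds = concat (map strands L)"
    using image_mset_eq_mset_lift[OF N(1)] by blast
  then show ?thesis using oriented_code_of_strands[of ds L] N(2) that by (auto simp: balanced_def)
qed

lemma total_outflow_outside: "x \<notin> labels (map fst OL) \<Longrightarrow> total_outflow OL x = 0"
proof (induction OL)
  case (Cons X OL)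
  obtain P u v where "X = (P, u, v)" by (metis prod_cases3)
  then show ?case using Cons by (cases P) (auto simp: unit_flow_def)
qed simp

lemma total_self_sign_cong:
  assumes "\<And>p q. p \<in> labels (map fst OL) \<Longrightarrow> q \<in> labels (map fst OL) \<Longrightarrow>
      \<kappa> p = \<kappa> q \<longleftrightarrow> \<kappa>' p = \<kappa>' q"
  shows "total_self_sign \<kappa> OL = total_self_sign \<kappa>' OL"
  using assms
proof (induction OL)
  case (Cons X OL)
  obtain P u v where X: "X = (P, u, v)" by (metis prod_cases3)
  have "self_sign \<kappa> X = self_sign \<kappa>' X"
    using Cons.prems X by (cases P) auto
  then show ?case using Cons by simp
qed simp

definition map_oriented :: "('a \<Rightarrow> 'b) \<Rightarrow> ('a piece \<times> bool \<times> bool) list \<Rightarrow>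
    ('b piece \<times> bool \<times> bool) list" where
  "map_oriented f OL = map (map_prod (map_piece f) id) OL"

lemma map_fst_map_oriented [simp]: "map fst (map_oriented f OL) = map (map_piece f) (map fst OL)"
  by (simp add: map_oriented_def)

lemma total_self_sign_map_oriented:
  "total_self_sign \<kappa> (map_oriented f OL) = total_self_sign (\<kappa> \<circ> f) OL"
proof (induction OL)
  case (Cons X OL)
  obtain P u v where X: "X = (P, u, v)" by (metis prod_cases3)
  have "self_sign \<kappa> (map_prod (map_piece f) id X) = self_sign (\<lambda>p. \<kappa> (f p)) X"
    using X by (cases P) auto
  then show ?case using Cons by (simp add: map_oriented_def o_def)
qed (simp add: map_oriented_def)

lemma unit_flow_image:
  assumes "finite V" "p \<in> V" "q \<in> V"
  shows "unit_flow u (f p) (f q) y = (\<Sum>x | x \<in> V \<and> f x = y. unit_flow u p q x)"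
proof -
  have "(\<Sum>x | x \<in> V \<and> f x = y. of_bool (x = r) :: int) = of_bool (y = f r)" if "r \<in> V" for r
    using assms(1) that by (auto simp: of_bool_def sum.If_cases Int_def cong: conj_cong)
  then show ?thesis using assms
    by (simp add: unit_flow_def sum_subtractf flip: sum_distrib_left)
qed

text \<open>
  Identifying labels adds up their flows, so Kirchhoff's law survives every renaming, injective or
  not.
\<close>

lemma total_outflow_map_oriented:
  "total_outflow (map_oriented f OL) y =
     (\<Sum>x | x \<in> labels (map fst OL) \<and> f x = y. total_outflow OL x)"
proof -
  have "total_outflow (map_oriented f OM) y = (\<Sum>x | x \<in> V \<and> f x = y. total_outflow OM x)"
    if "labels (map fst OM) \<subseteq> V" "finite V" for OM V
    using that
  proof (induction OM)
    case (Cons X OM)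
    obtain P u v where X: "X = (P, u, v)" by (metis prod_cases3)
    have "outflow (map_prod (map_piece f) id X) y = (\<Sum>x | x \<in> V \<and> f x = y. outflow X x)"
      using Cons.prems X by (cases P) (simp_all add: unit_flow_image[of V] sum.distrib)
    then show ?case using Cons by (simp add: map_oriented_def sum.distrib)
  qed (simp add: map_oriented_def)
  then show ?thesis by simp
qed

lemma balanced_map_oriented: "balanced OL \<Longrightarrow> balanced (map_oriented f OL)"
  by (simp add: balanced_def total_outflow_map_oriented)

section \<open>The self-writhe under recoding and local replacement\<close>

lemma self_writhe_permute:
  assumes "mset L = mset M" "closed_code L" "closed_code M"
  shows "self_writhe L = self_writhe M"
proof -
  obtain OL where OL: "map fst OL = L" "balanced OL"
    using balanced_orientation_exists[OF assms(2)] .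
  have "image_mset fst (mset OL) = mset M" using OL(1) assms(1) by (simp flip: mset_map)
  then obtain OM where OM: "mset OM = mset OL" "map fst OM = M"
    using image_mset_eq_mset_lift by blast
  have flow: "total_outflow OK x = (\<Sum>X\<in>#mset OK. outflow X x)"
    for OK :: "(nat piece \<times> bool \<times> bool) list" and x
    by (simp add: total_outflow_def flip: sum_mset_sum_list)
  have sign: "total_self_sign \<kappa> OK = (\<Sum>X\<in>#mset OK. self_sign \<kappa> X)"
    for OK :: "(nat piece \<times> bool \<times> bool) list" and \<kappa> :: "nat \<Rightarrow> (nat \<Rightarrow> bool) set"
    by (simp add: total_self_sign_def flip: sum_mset_sum_list)
  have "balanced OM" using OL(2) by (simp add: balanced_def flow OM(1))
  moreover have "strand_class L = strand_class M"
  proof -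
    have "set L = set M" using assms(1) by (rule mset_eq_setD)
    then show ?thesis by (simp add: strand_class_def strand_invariant_def fun_eq_iff)
  qed
  moreover have "total_self_sign (strand_class M) OM = total_self_sign (strand_class M) OL"
    by (simp only: sign OM(1))
  ultimately show ?thesis
    using self_writhe_eq_total_self_sign[of OL] self_writhe_eq_total_self_sign[of OM]
      assms(2,3) OL OM(2) by simp
qed

lemma self_writhe_rename:
  assumes inj: "inj_on f (labels L)" and "closed_code L" "closed_code (map (map_piece f) L)"
  shows "self_writhe (map (map_piece f) L) = self_writhe L"
proof -
  obtain OL where OL: "map fst OL = L" "balanced OL"
    using balanced_orientation_exists[OF assms(2)] .
  let ?fL = "map (map_piece f) L"
  have "strand_class ?fL (f p) = strand_class ?fL (f q) \<longleftrightarrow> strand_class L p = strand_class L q"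
    if pq: "p \<in> labels L" "q \<in> labels L" for p q
  proof
    assume *: "strand_class ?fL (f p) = strand_class ?fL (f q)"
    show "strand_class L p = strand_class L q" unfolding strand_class_eq_iff
    proof (intro allI impI)
      fix g :: "nat \<Rightarrow> bool" assume g: "strand_invariant g L"
      define h where "h = g \<circ> inv_into (labels L) f"
      have h: "h (f r) = g r" if "r \<in> labels L" for r using inj that by (simp add: h_def)
      then have "strand_invariant h ?fL"
        using g strand_invariant_cong[of L "h \<circ> f" g] by (simp add: strand_invariant_map_piece)
      then show "g p = g q" using * h pq unfolding strand_class_eq_iff by metis
    qed
  next
    assume *: "strand_class L p = strand_class L q"
    show "strand_class ?fL (f p) = strand_class ?fL (f q)" unfolding strand_class_eq_iff
    proof (intro allI impI)
      fix g :: "nat \<Rightarrow> bool" assume "strand_invariant g ?fL"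
      then have "strand_invariant (g \<circ> f) L" by (simp add: strand_invariant_map_piece)
      with * have "(g \<circ> f) p = (g \<circ> f) q" unfolding strand_class_eq_iff by blast
      then show "g (f p) = g (f q)" by simp
    qed
  qed
  then have "total_self_sign (strand_class ?fL) (map_oriented f OL) = total_self_sign (strand_class L) OL"
    unfolding total_self_sign_map_oriented by (intro total_self_sign_cong) (simp add: OL(1))
  then show ?thesis
    using self_writhe_eq_total_self_sign[of OL] self_writhe_eq_total_self_sign[of "map_oriented f OL"]
      assms(2,3) OL balanced_map_oriented[OF OL(2), of f] by simp
qed

text \<open>
  Identifying \<open>q\<close> with \<open>p\<close> turns the arc into a loop at \<open>p\<close>, which contributes no flow and can be
  dropped.
\<close>

lemma self_writhe_remove_point:
  assumes "p \<noteq> q" "closed_code (Arc p q # L)" "closed_code (map (map_piece (id(q := p))) L)"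
  shows "self_writhe (map (map_piece (id(q := p))) L) = self_writhe (Arc p q # L)"
proof -
  let ?f = "id(q := p)" and ?A = "Arc p q # L"
  let ?fL = "map (map_piece ?f) L"
  obtain OA where OA: "map fst OA = ?A" "balanced OA"
    using balanced_orientation_exists[OF assms(2)] .
  then obtain u v OL where OL: "OA = (Arc p q, u, v) # OL" "map fst OL = L" by (cases OA) auto
  have "outflow (map_prod (map_piece ?f) id (Arc p q, u, v)) x = 0" for x
    by (simp add: unit_flow_def)
  then have bal: "balanced (map_oriented ?f OL)"
    using balanced_map_oriented[OF OA(2), of ?f] unfolding balanced_def map_oriented_def OL(1) by simp
  have "strand_class ?fL (?f a) = strand_class ?fL (?f b) \<longleftrightarrow> strand_class ?A a = strand_class ?A b" for a b
  proof
    assume *: "strand_class ?fL (?f a) = strand_class ?fL (?f b)"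
    show "strand_class ?A a = strand_class ?A b" unfolding strand_class_eq_iff
    proof (intro allI impI)
      fix g :: "nat \<Rightarrow> bool" assume g: "strand_invariant g ?A"
      then have gf: "g \<circ> ?f = g" by (auto simp: fun_eq_iff)
      from g have "strand_invariant g L" by simp
      then have "strand_invariant g ?fL" unfolding strand_invariant_map_piece gf .
      then have "g (?f a) = g (?f b)" using * unfolding strand_class_eq_iff by blast
      then show "g a = g b" using gf by (metis comp_apply)
    qed
  next
    assume *: "strand_class ?A a = strand_class ?A b"
    show "strand_class ?fL (?f a) = strand_class ?fL (?f b)" unfolding strand_class_eq_iff
    proof (intro allI impI)
      fix g :: "nat \<Rightarrow> bool" assume "strand_invariant g ?fL"
      then have "strand_invariant (g \<circ> ?f) L" unfolding strand_invariant_map_piece .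
      then have "strand_invariant (g \<circ> ?f) ?A" by simp
      with * have "(g \<circ> ?f) a = (g \<circ> ?f) b" unfolding strand_class_eq_iff by blast
      then show "g (?f a) = g (?f b)" by simp
    qed
  qed
  then have "total_self_sign (strand_class ?fL) (map_oriented ?f OL) = total_self_sign (strand_class ?A) OL"
    unfolding total_self_sign_map_oriented by (intro total_self_sign_cong) (simp only: comp_apply)
  moreover have "self_writhe ?fL = total_self_sign (strand_class ?fL) (map_oriented ?f OL)"
    using self_writhe_eq_total_self_sign[of "map_oriented ?f OL"] assms(3) OL bal by simp
  moreover have "self_writhe ?A = total_self_sign (strand_class ?A) OL"
    using self_writhe_eq_total_self_sign[of OA] assms(2) OA OL by simp
  ultimately show ?thesis by simp
qed

text \<open>
  The disk \<open>T\<close> joins no two boundary points that \<open>T'\<close> keeps apart: every invariant of \<open>T'\<close>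
  becomes one of \<open>T\<close> once it is redefined on the interior labels \<open>js\<close> of \<open>T\<close>.
\<close>

definition invariants_extend :: "'a list \<Rightarrow> 'a piece list \<Rightarrow> 'a piece list \<Rightarrow> bool" where
  "invariants_extend js T' T \<longleftrightarrow> (\<forall>g :: 'a \<Rightarrow> bool. strand_invariant g T' \<longrightarrow>
     (\<exists>h. (\<forall>x. x \<notin> set js \<longrightarrow> h x = g x) \<and> strand_invariant h T))"

lemma invariants_extendI:
  assumes "\<And>g x. x \<notin> set js \<Longrightarrow> h g x = g x"
    and "\<And>g :: 'a \<Rightarrow> bool. strand_invariant g T' \<Longrightarrow> strand_invariant (h g) T"
  shows "invariants_extend js T' T"
  using assms unfolding invariants_extend_def by blast

type_synonym 'a naming = "'a \<Rightarrow> ('a \<Rightarrow> bool) set"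

text \<open>
  The orientation \<open>OT\<close> of one disk has a counterpart on the other disk \<open>T'\<close> with the same flow
  through the boundary.  The signs of their self-crossings differ by \<open>k\<close> in total, whichever
  components the boundary points \<open>bs\<close> belong to.  The outside enters only through the
  names \<open>\<kappa>\<close> and \<open>\<kappa>'\<close> of the components in the two diagrams, which identify the same boundary points.
\<close>

definition transferable ::
  "'a list \<Rightarrow> int \<Rightarrow> ('a piece \<times> bool \<times> bool) list \<Rightarrow> 'a piece list \<Rightarrow> bool" where
  "transferable bs k OT T' \<longleftrightarrow>
     (\<exists>OT'. map fst OT' = T' \<and> (\<forall>x. total_outflow OT' x = total_outflow OT x) \<and>
        (\<forall>(\<kappa> :: 'a naming) (\<kappa>' :: 'a naming).
           strand_invariant \<kappa> (map fst OT) \<longrightarrow> strand_invariant \<kappa>' T' \<longrightarrow>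
           (\<forall>x\<in>set bs. \<forall>y\<in>set bs. \<kappa> x = \<kappa> y \<longleftrightarrow> \<kappa>' x = \<kappa>' y) \<longrightarrow>
           total_self_sign \<kappa> OT = total_self_sign \<kappa>' OT' + k))"

lemma transferableI:
  assumes "map fst OT' = T'" "\<And>x. total_outflow OT' x = total_outflow OT x"
    and "\<And>(\<kappa> :: 'a naming) (\<kappa>' :: 'a naming).
           strand_invariant \<kappa> (map fst OT) \<Longrightarrow> strand_invariant \<kappa>' T' \<Longrightarrow>
           (\<And>x y. x \<in> set bs \<Longrightarrow> y \<in> set bs \<Longrightarrow> \<kappa> x = \<kappa> y \<longleftrightarrow> \<kappa>' x = \<kappa>' y) \<Longrightarrow>
           total_self_sign \<kappa> OT = total_self_sign \<kappa>' OT' + k"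
  shows "transferable bs k OT T'"
  unfolding transferable_def using assms by blast

text \<open>
  Since invariants extend in both directions, labels outside the disks lie on the same component in
  both diagrams, so the crossings outside contribute the same amount with the transferred orientation.
\<close>

lemma self_writhe_replace:
  assumes closed: "closed_code (T @ S)" "closed_code (T' @ S)"
    and interface: "has_interface T bs js" "has_interface T' bs js'"
    and extend: "invariants_extend js T' T" "invariants_extend js' T T'"
    and transfer: "\<And>OT. map fst OT = T \<Longrightarrow> \<forall>x\<in>set js. total_outflow OT x = 0 \<Longrightarrow>
          transferable bs k OT T'"
  shows "self_writhe (T @ S) = self_writhe (T' @ S) + k"
proof -
  note fresh = has_interface_fresh[OF interface(1) closed(1)]
    and fresh' = has_interface_fresh[OF interface(2) closed(2)]
  let ?\<kappa> = "strand_class (T @ S)" and ?\<kappa>' = "strand_class (T' @ S)"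
  have transport: "strand_class (U' @ S) x = strand_class (U' @ S) y"
    if eq: "strand_class (U @ S) x = strand_class (U @ S) y"
      and ext: "invariants_extend is U' U"
      and out: "set is \<inter> labels S = {}" "x \<notin> set is" "y \<notin> set is"
    for U U' x y "is"
    unfolding strand_class_eq_iff
  proof (intro allI impI)
    fix g :: "nat \<Rightarrow> bool" assume g: "strand_invariant g (U' @ S)"
    then obtain h where h: "\<forall>x. x \<notin> set is \<longrightarrow> h x = g x" "strand_invariant h U"
      using ext unfolding invariants_extend_def by auto
    have "strand_invariant h S \<longleftrightarrow> strand_invariant g S"
      using h(1) out(1) by (intro strand_invariant_cong) auto
    then have "strand_invariant h (U @ S)" using g h(2) by simp
    then show "g x = g y" using eq h(1) out(2,3) unfolding strand_class_eq_iff by metis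
  qed
  have outside: "?\<kappa> x = ?\<kappa> y \<longleftrightarrow> ?\<kappa>' x = ?\<kappa>' y"
    if "x \<in> set bs \<union> labels S" "y \<in> set bs \<union> labels S" for x y
  proof -
    have "x \<notin> set js" "y \<notin> set js" "x \<notin> set js'" "y \<notin> set js'"
      using that fresh fresh' by auto
    then show ?thesis
      using transport[of T x y js T', OF _ extend(1) fresh(3)]
        transport[of T' x y js' T, OF _ extend(2) fresh'(3)] by blast
  qed
  obtain OTS where OTS: "map fst OTS = T @ S" "balanced OTS"
    using balanced_orientation_exists[OF closed(1)] .
  then obtain OT OS where O: "OTS = OT @ OS" "map fst OT = T" "map fst OS = S"
    by (metis map_eq_append_conv)
  have "total_outflow OT x = 0" if "x \<in> set js" for x
  proof -
    have "total_outflow OS x = 0" using that fresh(3) O(3) by (intro total_outflow_outside) auto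
    moreover have "total_outflow OT x + total_outflow OS x = 0"
      using OTS(2) by (simp add: balanced_def O(1))
    ultimately show ?thesis by simp
  qed
  then have "\<forall>x\<in>set js. total_outflow OT x = 0" by blast
  from transfer[OF O(2) this] obtain OT'
    where OT': "map fst OT' = T'" "\<forall>x. total_outflow OT' x = total_outflow OT x"
      "\<forall>(\<kappa> :: nat naming) (\<kappa>' :: nat naming).
         strand_invariant \<kappa> T \<longrightarrow> strand_invariant \<kappa>' T' \<longrightarrow>
         (\<forall>x\<in>set bs. \<forall>y\<in>set bs. \<kappa> x = \<kappa> y \<longleftrightarrow> \<kappa>' x = \<kappa>' y) \<longrightarrow>
         total_self_sign \<kappa> OT = total_self_sign \<kappa>' OT' + k"
    unfolding transferable_def O(2) by blast
  have "balanced (OT' @ OS)" using OTS(2) OT'(2) by (simp add: balanced_def O(1))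
  moreover have "total_self_sign ?\<kappa> OT = total_self_sign ?\<kappa>' OT' + k"
  proof (rule OT'(3)[rule_format])
    show "strand_invariant ?\<kappa> T" "strand_invariant ?\<kappa>' T'"
      using strand_invariant_strand_class[of "T @ S"] strand_invariant_strand_class[of "T' @ S"]
      by (simp_all only: strand_invariant_append)
    show "?\<kappa> x = ?\<kappa> y \<longleftrightarrow> ?\<kappa>' x = ?\<kappa>' y" if "x \<in> set bs" "y \<in> set bs" for x y
      using outside that by blast
  qed
  moreover have "total_self_sign ?\<kappa> OS = total_self_sign ?\<kappa>' OS"
    using outside O(3) by (intro total_self_sign_cong) blast
  ultimately show ?thesis
    using self_writhe_eq_total_self_sign[of OTS] self_writhe_eq_total_self_sign[of "OT' @ OS"]
      closed OTS O OT'(1) by simp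
qed

section \<open>The bracket under the moves\<close>

text \<open>
  Both orders of every inequation, in the form in which the simplifier evaluates updates at interior
  labels.
\<close>

lemma has_interface_neq:
  assumes "has_interface T bs js" "closed_code (T @ S)"
  shows "distinct js" "distinct (rev js)" "\<forall>x\<in>set js. \<forall>y\<in>set bs. x \<noteq> y \<and> y \<noteq> x"
  using has_interface_fresh[OF assms] by auto

text \<open>
  Only the weights of patterns \<open>z\<close> and \<open>w\<close> are left, and in both the two ends of each strand have
  different colours.
\<close>

lemma local_weight_crossing:
  "local_weight 0 0 z w l (Crossing a b c d) =
     (if l c \<noteq> l b \<and> l d \<noteq> l a then if l a = l b then z else w else 0)"
  by (cases "l a"; cases "l b"; cases "l c"; cases "l d"; simp add: weight_def)

declare local_weight.simps(2) [simp del]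

lemmas expand_weights = total_weight_def sum_out_def local_weight_crossing

text \<open>
  The colour changes along both strands at every crossing and is constant on arcs and vertices,
  so the interior colours are forced by those at the boundary, and it remains to compare finitely
  many products of \<open>z\<close> and \<open>w\<close>.  In \<open>\<Omega>\<^sub>4\<close> the two crossings with \<open>H\<close> see the same colour on the arms
  of the vertex and opposite colours on \<open>H\<close>, so one of them has weight \<open>z\<close> and the other \<open>w\<close>.
\<close>

lemma bracket_local_move:
  fixes z w :: "'r::comm_ring_1"
  assumes "local_move m T T'" "closed_code (T @ S)" "closed_code (T' @ S)" and zw: "z * w = 1"
  shows "bracket (T @ S) 0 0 z w = (if m = Omega1 then w else 1) * bracket (T' @ S) 0 0 z w"
proof -
  have zw': "w * z = 1" "z * (w * u) = u" "w * (z * u) = u" for u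
    using zw by (simp_all add: mult.commute[of w z] flip: mult.assoc)
  show ?thesis
    using assms(1-3)
  proof (induction rule: local_move.induct)
    case (omega1 a e b)
    have i: "has_interface [Crossing a e b e] [a, b] [e]" "has_interface [Arc a b] [a, b] []"
      by (simp_all add: has_interface_def)
    note neq = has_interface_neq[OF i(1) omega1(1), simplified]
    show ?case
      by (rule bracket_replace[OF omega1 i]) (simp add: expand_weights neq)
  next
    case (omega2 a c e f b d)
    have i: "has_interface [CrossingNWSE a c e f, Crossing e f b d] [a, b, c, d] [e, f]"
      "has_interface [Arc a b, Arc c d] [a, b, c, d] []"
      by (simp_all add: has_interface_def)
    note neq = has_interface_neq[OF i(1) omega2(1), simplified]
    show ?case
      unfolding move.distinct if_False by (rule bracket_replace[OF omega2 i])
        (auto simp: expand_weights neq zw zw')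
  next
    case (omega3 t1 t2 e f h1 g b1 h2 b2)
    have i: "has_interface [CrossingNWSE t1 t2 e f, Over h1 g e b1, Over g h2 f b2]
        [t1, t2, b1, b2, h1, h2] [e, f, g]"
      "has_interface [Over h1 g t1 e, Over g h2 t2 f, CrossingNWSE e f b1 b2]
        [t1, t2, b1, b2, h1, h2] [e, f, g]"
      by (simp_all add: has_interface_def)
    note neq = has_interface_neq[OF i(1) omega3(1), simplified]
    show ?case
      by (rule bracket_replace[OF omega3 i])
        (auto simp: expand_weights neq zw zw')
  next
    case (omega4 t1 t2 e f h1 g b1 h2 b2)
    have i: "has_interface [Vertex t1 t2 e f, Over h1 g e b1, Over g h2 f b2]
        [t1, t2, b1, b2, h1, h2] [e, f, g]"
      "has_interface [Over h1 g t1 e, Over g h2 t2 f, Vertex e f b1 b2]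
        [t1, t2, b1, b2, h1, h2] [e, f, g]"
      by (simp_all add: has_interface_def)
    note neq = has_interface_neq[OF i(1) omega4(1), simplified]
    show ?case
      by (rule bracket_replace[OF omega4 i])
        (auto simp: expand_weights neq zw zw')
  next
    case (omega4' t1 t2 e f h1 g b1 h2 b2)
    have i: "has_interface [Vertex t1 t2 e f, Under h1 g e b1, Under g h2 f b2]
        [t1, t2, b1, b2, h1, h2] [e, f, g]"
      "has_interface [Under h1 g t1 e, Under g h2 t2 f, Vertex e f b1 b2]
        [t1, t2, b1, b2, h1, h2] [e, f, g]"
      by (simp_all add: has_interface_def)
    note neq = has_interface_neq[OF i(1) omega4'(1), simplified]
    show ?case
      by (rule bracket_replace[OF omega4' i])
        (auto simp: expand_weights neq zw zw')
  next
    case (omega5 a e b f c d)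
    have i: "has_interface [Crossing a e b f, Vertex e c f d] [a, b, c, d] [e, f]"
      "has_interface [Vertex a e b f, Crossing e c f d] [a, b, c, d] [e, f]"
      by (simp_all add: has_interface_def)
    note neq = has_interface_neq[OF i(1) omega5(1), simplified]
    show ?case
      by (rule bracket_replace[OF omega5 i])
        (auto simp: expand_weights neq)
  next
    case (omega6 a e b)
    have i: "has_interface [VertexV a e b e] [a, b] [e]" "has_interface [Arc a b] [a, b] []"
      by (simp_all add: has_interface_def)
    note neq = has_interface_neq[OF i(1) omega6(1), simplified]
    show ?case
      by (rule bracket_replace[OF omega6 i]) (auto simp: expand_weights neq)
  next
    case (omega6' a e b)
    have i: "has_interface [Vertex a e b e] [a, b] [e]" "has_interface [Arc a b] [a, b] []"
      by (simp_all add: has_interface_def)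
    note neq = has_interface_neq[OF i(1) omega6'(1), simplified]
    show ?case
      by (rule bracket_replace[OF omega6' i]) (auto simp: expand_weights neq)
  next
    case (omega7 t1 e b1 b2 t2 t3 b3)
    have "bracket ([VertexV t1 e b1 b2, Vertex t2 t3 e b3] @ S) 0 0 z w
        = bracket ([VertexV t1 t2 b1 e, Vertex e t3 b2 b3] @ S) 0 0 z w"
    proof (rule bracket_cong)
      fix l :: "nat \<Rightarrow> bool"
      show "total_weight 0 0 z w l ([VertexV t1 e b1 b2, Vertex t2 t3 e b3] @ S)
        = total_weight 0 0 z w l ([VertexV t1 t2 b1 e, Vertex e t3 b2 b3] @ S)"
        by (cases "l e") (auto simp: expand_weights)
    qed auto
    then show ?case by simp
  next
    case (omega8 t1 t2 e1 f1 t3 t4 g1 h1 g2 f2 b1 e2 h2 b4 b2 b3)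
    let ?v = "[VertexV t1 t2 e1 f1, Vertex t3 t4 g1 h1]"
    let ?c = "[Crossing f1 g1 g2 f2, Crossing e1 g2 b1 e2, Crossing f2 h1 h2 b4,
        Crossing e2 h2 b2 b3]"
    let ?c' = "[CrossingNWSE f1 g1 g2 f2, CrossingNWSE e1 g2 b1 e2, CrossingNWSE f2 h1 h2 b4,
        CrossingNWSE e2 h2 b2 b3]"
    have "bracket ((?v @ ?c) @ S) 0 0 z w = bracket ((?v @ ?c') @ S) 0 0 z w"
    proof (rule bracket_cong)
      fix l :: "nat \<Rightarrow> bool"
      have "total_weight 0 0 z w l ?v * total_weight 0 0 z w l ?c
          = total_weight 0 0 z w l ?v * total_weight 0 0 z w l ?c'"
      proof (cases "l e1 = l f1 \<and> l g1 = l h1")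
        case True
        then have "total_weight 0 0 z w l ?c = total_weight 0 0 z w l ?c'"
          by (cases "l f1"; cases "l g1") (simp_all add: expand_weights zw zw')
        then show ?thesis by simp
      next
        case False
        then have "total_weight 0 0 z w l ?v = 0" by (auto simp: expand_weights)
        then show ?thesis by simp
      qed
      then show "total_weight 0 0 z w l ((?v @ ?c) @ S) = total_weight 0 0 z w l ((?v @ ?c') @ S)"
        by (simp only: total_weight_append)
    qed auto
    then show ?case by simp
  qed
qed

section \<open>The self-writhe under the moves\<close>

lemma map_fst_eq_Cons:
  "map fst OT = P # T \<longleftrightarrow> (\<exists>u v OT0. OT = (P, u, v) # OT0 \<and> map fst OT0 = T)"
  by (cases OT) auto

text \<open>
  In this and the following proofs, the vanishing of the flow at the interior labels means that the
  strands inside the disk are directed coherently, and the other disk is given an orientation with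
  the same directions at the boundary points.  Here both strands of the kink leave or both enter on the side of \<open>NE\<close> and
  \<open>NW\<close>: the kink is positive, and its arms lie on one component.
\<close>

lemma self_writhe_omega1:
  assumes "closed_code ([Crossing a e b e] @ S)" "closed_code ([Arc a b] @ S)"
  shows "self_writhe ([Crossing a e b e] @ S) = self_writhe ([Arc a b] @ S) + 1"
proof -
  let ?T = "[Crossing a e b e]" and ?T' = "[Arc a b]"
  have i: "has_interface ?T [a, b] [e]" "has_interface ?T' [a, b] []"
    by (simp_all add: has_interface_def)
  note neq = has_interface_neq[OF i(1) assms(1), simplified]
  show ?thesis
  proof (rule self_writhe_replace[OF assms i])
    show "invariants_extend [e] ?T' ?T"
      by (rule invariants_extendI[where h = "\<lambda>g. g(e := g a)"]) (use neq in auto)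
    show "invariants_extend [] ?T ?T'"
      by (rule invariants_extendI[where h = "\<lambda>g. g"]) auto
  next
    fix OT :: "(nat piece \<times> bool \<times> bool) list"
    assume "map fst OT = ?T" and 0: "\<forall>x\<in>set [e]. total_outflow OT x = 0"
    then obtain u v where OT: "OT = [(Crossing a e b e, u, v)]" by (auto simp: map_fst_eq_Cons)
    have "v = u" using 0 neq by (auto simp: OT unit_flow_def split: if_splits)
    note OT = OT[unfolded this]
    show "transferable [a, b] 1 OT ?T'"
      by (rule transferableI[where OT' = "[(Arc a b, u, True)]"])
        (auto simp: OT unit_flow_def)
  qed
qed

text \<open>
  The two crossings of the bigon involve the same two arcs with opposite signs.
\<close>

lemma self_writhe_omega2:
  assumes "closed_code ([CrossingNWSE a c e f, Crossing e f b d] @ S)"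
    "closed_code ([Arc a b, Arc c d] @ S)"
  shows "self_writhe ([CrossingNWSE a c e f, Crossing e f b d] @ S)
      = self_writhe ([Arc a b, Arc c d] @ S)"
proof -
  let ?T = "[CrossingNWSE a c e f, Crossing e f b d]" and ?T' = "[Arc a b, Arc c d]"
  have i: "has_interface ?T [a, b, c, d] [e, f]" "has_interface ?T' [a, b, c, d] []"
    by (simp_all add: has_interface_def)
  note neq = has_interface_neq[OF i(1) assms(1), simplified]
  have "self_writhe (?T @ S) = self_writhe (?T' @ S) + 0"
  proof (rule self_writhe_replace[OF assms i])
    show "invariants_extend [e, f] ?T' ?T"
      by (rule invariants_extendI[where h = "\<lambda>g. g(e := g c, f := g a)"]) (use neq in auto)
    show "invariants_extend [] ?T ?T'"
      by (rule invariants_extendI[where h = "\<lambda>g. g"]) auto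
  next
    fix OT :: "(nat piece \<times> bool \<times> bool) list"
    assume "map fst OT = ?T" and 0: "\<forall>x\<in>set [e, f]. total_outflow OT x = 0"
    then obtain u1 v1 u2 v2
      where OT: "OT = [(CrossingNWSE a c e f, u1, v1), (Crossing e f b d, u2, v2)]"
      by (auto simp: map_fst_eq_Cons)
    have "u2 = u1" "v2 = (\<not> v1)"
      using 0 neq by (auto simp: OT unit_flow_def split: if_splits)
    note OT = OT[unfolded this]
    show "transferable [a, b, c, d] 0 OT ?T'"
      by (rule transferableI[where OT' = "[(Arc a b, u1, True), (Arc c d, \<not> v1, True)]"])
        (auto simp: OT unit_flow_def)
  qed
  then show ?thesis by simp
qed

text \<open>
  Each of the three pairs of strands crosses once on either side, with the same sign.
\<close>

lemma self_writhe_omega3: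
  assumes "closed_code ([CrossingNWSE t1 t2 e f, Over h1 g e b1, Over g h2 f b2] @ S)"
    "closed_code ([Over h1 g t1 e, Over g h2 t2 f, CrossingNWSE e f b1 b2] @ S)"
  shows "self_writhe ([CrossingNWSE t1 t2 e f, Over h1 g e b1, Over g h2 f b2] @ S)
      = self_writhe ([Over h1 g t1 e, Over g h2 t2 f, CrossingNWSE e f b1 b2] @ S)"
proof -
  let ?T = "[CrossingNWSE t1 t2 e f, Over h1 g e b1, Over g h2 f b2]"
    and ?T' = "[Over h1 g t1 e, Over g h2 t2 f, CrossingNWSE e f b1 b2]"
  let ?bs = "[t1, t2, b1, b2, h1, h2]" and ?js = "[e, f, g]"
  have i: "has_interface ?T ?bs ?js" "has_interface ?T' ?bs ?js"
    by (simp_all add: has_interface_def)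
  note neq = has_interface_neq[OF i(1) assms(1), simplified]
  have "self_writhe (?T @ S) = self_writhe (?T' @ S) + 0"
  proof (rule self_writhe_replace[OF assms i])
    show "invariants_extend ?js ?T' ?T"
      by (rule invariants_extendI[where h = "\<lambda>c. c(e := c t2, f := c t1)"]) (use neq in auto)
    show "invariants_extend ?js ?T ?T'"
      by (rule invariants_extendI[where h = "\<lambda>c. c(e := c t1, f := c t2)"]) (use neq in auto)
  next
    fix OT :: "(nat piece \<times> bool \<times> bool) list"
    assume "map fst OT = ?T" and 0: "\<forall>x\<in>set ?js. total_outflow OT x = 0"
    then obtain u1 v1 u2 v2 u3 v3
      where OT: "OT = [(CrossingNWSE t1 t2 e f, u1, v1), (Over h1 g e b1, u2, v2),
        (Over g h2 f b2, u3, v3)]"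
      by (auto simp: map_fst_eq_Cons)
    have "v2 = (\<not> v1)" "u3 = u2" "v3 = u1"
      using 0 neq by (auto simp: OT unit_flow_def split: if_splits)
    note OT = OT[unfolded this]
    show "transferable ?bs 0 OT ?T'"
    proof (rule transferableI[where OT' = "[(Over h1 g t1 e, u2, u1), (Over g h2 t2 f, u2, \<not> v1),
          (CrossingNWSE e f b1 b2, u1, v1)]"])
      fix \<kappa> \<kappa>' :: "nat naming"
      assume \<kappa>: "strand_invariant \<kappa> (map fst OT)" "strand_invariant \<kappa>' ?T'"
        "\<And>x y. x \<in> set ?bs \<Longrightarrow> y \<in> set ?bs \<Longrightarrow> \<kappa> x = \<kappa> y \<longleftrightarrow> \<kappa>' x = \<kappa>' y"
      show "total_self_sign \<kappa> OT = total_self_sign \<kappa>' [(Over h1 g t1 e, u2, u1),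
          (Over g h2 t2 f, u2, \<not> v1), (CrossingNWSE e f b1 b2, u1, v1)] + 0"
      proof -
        have "\<kappa> e = \<kappa> t2" "\<kappa> f = \<kappa> t1" "\<kappa> g = \<kappa> h1" "\<kappa> h2 = \<kappa> h1"
          using \<kappa>(1) by (simp_all add: OT)
        moreover have "\<kappa>' e = \<kappa>' t1" "\<kappa>' b1 = \<kappa>' t2" "\<kappa>' g = \<kappa>' h1" "\<kappa>' h2 = \<kappa>' h1"
          using \<kappa>(2) by simp_all
        ultimately show ?thesis
          using \<kappa>(3)[of t1 t2] \<kappa>(3)[of h1 t1] \<kappa>(3)[of h1 t2] by (simp add: OT)
      qed
    qed (cases u1; cases v1; cases u2; simp add: OT unit_flow_def)+
  qed
  then show ?thesis by simp
qed

text \<open>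
  On both sides \<open>H\<close> crosses one arc of the smoothed vertex twice, in opposite directions, so the
  two signs cancel whether or not the arc and \<open>H\<close> lie on the same component.
\<close>

lemma self_writhe_omega4:
  assumes "closed_code ([Arc t1 t2, Arc e f, Over h1 g e b1, Over g h2 f b2] @ S)"
    "closed_code ([Over h1 g t1 e, Over g h2 t2 f, Arc e f, Arc b1 b2] @ S)"
  shows "self_writhe ([Arc t1 t2, Arc e f, Over h1 g e b1, Over g h2 f b2] @ S)
      = self_writhe ([Over h1 g t1 e, Over g h2 t2 f, Arc e f, Arc b1 b2] @ S)"
proof -
  let ?T = "[Arc t1 t2, Arc e f, Over h1 g e b1, Over g h2 f b2]"
    and ?T' = "[Over h1 g t1 e, Over g h2 t2 f, Arc e f, Arc b1 b2]"
  let ?bs = "[t1, t2, b1, b2, h1, h2]"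
  have i: "has_interface ?T ?bs [e, f, g]" "has_interface ?T' ?bs [e, f, g]"
    by (simp_all add: has_interface_def)
  note neq = has_interface_neq[OF i(1) assms(1), simplified]
  have "self_writhe (?T @ S) = self_writhe (?T' @ S) + 0"
  proof (rule self_writhe_replace[OF assms i])
    show "invariants_extend [e, f, g] ?T' ?T"
      by (rule invariants_extendI[where h = "\<lambda>c. c(e := c b1, f := c b1, g := c h1)"]) (use neq in auto)
    show "invariants_extend [e, f, g] ?T ?T'"
      by (rule invariants_extendI[where h = "\<lambda>c. c(e := c t1, f := c t1, g := c h1)"]) (use neq in auto)
  next
    fix OT :: "(nat piece \<times> bool \<times> bool) list"
    assume "map fst OT = ?T" and 0: "\<forall>x\<in>set [e, f, g]. total_outflow OT x = 0"
    then obtain u1 v1 u2 v2 u3 v3 u4 v4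
      where OT: "OT = [(Arc t1 t2, u1, v1), (Arc e f, u2, v2), (Over h1 g e b1, u3, v3),
          (Over g h2 f b2, u4, v4)]"
      by (auto simp: map_fst_eq_Cons)
    have flow: "total_outflow OT x = 0" if "x \<in> set [e, f, g]" for x
      using 0 that by blast
    have e: "v3 = (\<not> u2)"
      using flow[of e] by (simp add: OT unit_flow_def neq split: if_splits)
    have f: "v4 = u2"
      using flow[of f] by (simp add: OT unit_flow_def neq split: if_splits)
    have g: "u4 = u3"
      using flow[of g] by (simp add: OT unit_flow_def neq split: if_splits)
    note OT = OT[unfolded g f e]
    let ?OT' = "[(Over h1 g t1 e, u3, u1), (Over g h2 t2 f, u3, \<not> u1), (Arc e f, u1, True),
        (Arc b1 b2, u2, True)]"
    show "transferable ?bs 0 OT ?T'"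
    proof (rule transferableI[where OT' = ?OT'])
      fix \<kappa> \<kappa>' :: "nat naming"
      assume \<kappa>: "strand_invariant \<kappa> (map fst OT)" "strand_invariant \<kappa>' ?T'"
        "\<And>x y. x \<in> set ?bs \<Longrightarrow> y \<in> set ?bs \<Longrightarrow> \<kappa> x = \<kappa> y \<longleftrightarrow> \<kappa>' x = \<kappa>' y"
      show "total_self_sign \<kappa> OT = total_self_sign \<kappa>' ?OT' + 0"
      proof -
        have "\<kappa> e = \<kappa> b1" "\<kappa> f = \<kappa> b1" "\<kappa> g = \<kappa> h1" "\<kappa> h2 = \<kappa> h1"
          using \<kappa>(1) by (auto simp: OT)
        moreover have "\<kappa>' e = \<kappa>' t1" "\<kappa>' f = \<kappa>' t1" "\<kappa>' t2 = \<kappa>' t1" "\<kappa>' g = \<kappa>' h1" "\<kappa>' h2 = \<kappa>' h1"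
          using \<kappa>(2) by auto
        ultimately show ?thesis
          by (simp add: OT)
      qed
    qed (cases u1; cases u2; cases u3; simp add: OT unit_flow_def)+
  qed
  then show ?thesis by simp
qed

text \<open>
  The signs cancel as for \<open>self_writhe_omega4\<close>.
\<close>

lemma self_writhe_omega4':
  assumes "closed_code ([Arc t1 t2, Arc e f, Under h1 g e b1, Under g h2 f b2] @ S)"
    "closed_code ([Under h1 g t1 e, Under g h2 t2 f, Arc e f, Arc b1 b2] @ S)"
  shows "self_writhe ([Arc t1 t2, Arc e f, Under h1 g e b1, Under g h2 f b2] @ S)
      = self_writhe ([Under h1 g t1 e, Under g h2 t2 f, Arc e f, Arc b1 b2] @ S)"
proof -
  let ?T = "[Arc t1 t2, Arc e f, Under h1 g e b1, Under g h2 f b2]"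
    and ?T' = "[Under h1 g t1 e, Under g h2 t2 f, Arc e f, Arc b1 b2]"
  let ?bs = "[t1, t2, b1, b2, h1, h2]"
  have i: "has_interface ?T ?bs [e, f, g]" "has_interface ?T' ?bs [e, f, g]"
    by (simp_all add: has_interface_def)
  note neq = has_interface_neq[OF i(1) assms(1), simplified]
  have "self_writhe (?T @ S) = self_writhe (?T' @ S) + 0"
  proof (rule self_writhe_replace[OF assms i])
    show "invariants_extend [e, f, g] ?T' ?T"
      by (rule invariants_extendI[where h = "\<lambda>c. c(e := c b1, f := c b1, g := c h1)"]) (use neq in auto)
    show "invariants_extend [e, f, g] ?T ?T'"
      by (rule invariants_extendI[where h = "\<lambda>c. c(e := c t1, f := c t1, g := c h1)"]) (use neq in auto)
  next
    fix OT :: "(nat piece \<times> bool \<times> bool) list"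
    assume "map fst OT = ?T" and 0: "\<forall>x\<in>set [e, f, g]. total_outflow OT x = 0"
    then obtain u1 v1 u2 v2 u3 v3 u4 v4
      where OT: "OT = [(Arc t1 t2, u1, v1), (Arc e f, u2, v2), (Under h1 g e b1, u3, v3),
          (Under g h2 f b2, u4, v4)]"
      by (auto simp: map_fst_eq_Cons)
    have flow: "total_outflow OT x = 0" if "x \<in> set [e, f, g]" for x
      using 0 that by blast
    have e: "u3 = (\<not> u2)"
      using flow[of e] by (simp add: OT unit_flow_def neq split: if_splits)
    have f: "u4 = u2"
      using flow[of f] by (simp add: OT unit_flow_def neq split: if_splits)
    have g: "v4 = v3"
      using flow[of g] by (simp add: OT unit_flow_def neq split: if_splits)
    note OT = OT[unfolded g f e]
    let ?OT' = "[(Under h1 g t1 e, u1, v3), (Under g h2 t2 f, \<not> u1, v3), (Arc e f, u1, True),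
        (Arc b1 b2, u2, True)]"
    show "transferable ?bs 0 OT ?T'"
    proof (rule transferableI[where OT' = ?OT'])
      fix \<kappa> \<kappa>' :: "nat naming"
      assume \<kappa>: "strand_invariant \<kappa> (map fst OT)" "strand_invariant \<kappa>' ?T'"
        "\<And>x y. x \<in> set ?bs \<Longrightarrow> y \<in> set ?bs \<Longrightarrow> \<kappa> x = \<kappa> y \<longleftrightarrow> \<kappa>' x = \<kappa>' y"
      show "total_self_sign \<kappa> OT = total_self_sign \<kappa>' ?OT' + 0"
      proof -
        have "\<kappa> e = \<kappa> b1" "\<kappa> f = \<kappa> b1" "\<kappa> g = \<kappa> h1" "\<kappa> b2 = \<kappa> b1"
          using \<kappa>(1) by (auto simp: OT)
        moreover have "\<kappa>' e = \<kappa>' t1" "\<kappa>' f = \<kappa>' t1" "\<kappa>' t2 = \<kappa>' t1" "\<kappa>' g = \<kappa>' h1"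
          using \<kappa>(2) by auto
        ultimately show ?thesis
          by (simp add: OT)
      qed
    qed (cases u1; cases u2; cases v3; simp add: OT unit_flow_def)+
  qed
  then show ?thesis by simp
qed

text \<open>
  The twist between two strands slides through the smoothed vertex and keeps its sign.
\<close>

lemma self_writhe_omega5:
  assumes "closed_code ([Crossing a e b f, Arc e c, Arc f d] @ S)"
    "closed_code ([Arc a e, Arc b f, Crossing e c f d] @ S)"
  shows "self_writhe ([Crossing a e b f, Arc e c, Arc f d] @ S)
      = self_writhe ([Arc a e, Arc b f, Crossing e c f d] @ S)"
proof -
  let ?T = "[Crossing a e b f, Arc e c, Arc f d]"
    and ?T' = "[Arc a e, Arc b f, Crossing e c f d]"
  let ?bs = "[a, b, c, d]"
  have i: "has_interface ?T ?bs [e, f]" "has_interface ?T' ?bs [e, f]"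
    by (simp_all add: has_interface_def)
  note neq = has_interface_neq[OF i(1) assms(1), simplified]
  have "self_writhe (?T @ S) = self_writhe (?T' @ S) + 0"
  proof (rule self_writhe_replace[OF assms i])
    show "invariants_extend [e, f] ?T' ?T"
      by (rule invariants_extendI[where h = "\<lambda>c. c(e := c b, f := c a)"]) (use neq in auto)
    show "invariants_extend [e, f] ?T ?T'"
      by (rule invariants_extendI[where h = "\<lambda>c. c(e := c a, f := c b)"]) (use neq in auto)
  next
    fix OT :: "(nat piece \<times> bool \<times> bool) list"
    assume "map fst OT = ?T" and 0: "\<forall>x\<in>set [e, f]. total_outflow OT x = 0"
    then obtain u1 v1 u2 v2 u3 v3
      where OT: "OT = [(Crossing a e b f, u1, v1), (Arc e c, u2, v2), (Arc f d, u3, v3)]"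
      by (auto simp: map_fst_eq_Cons)
    have flow: "total_outflow OT x = 0" if "x \<in> set [e, f]" for x
      using 0 that by blast
    have e: "u2 = (\<not> u1)"
      using flow[of e] by (simp add: OT unit_flow_def neq split: if_splits)
    have f: "u3 = v1"
      using flow[of f] by (simp add: OT unit_flow_def neq split: if_splits)
    note OT = OT[unfolded f e]
    let ?OT' = "[(Arc a e, v1, True), (Arc b f, \<not> u1, True), (Crossing e c f d, u1, v1)]"
    show "transferable ?bs 0 OT ?T'"
    proof (rule transferableI[where OT' = ?OT'])
      fix \<kappa> \<kappa>' :: "nat naming"
      assume \<kappa>: "strand_invariant \<kappa> (map fst OT)" "strand_invariant \<kappa>' ?T'"
        "\<And>x y. x \<in> set ?bs \<Longrightarrow> y \<in> set ?bs \<Longrightarrow> \<kappa> x = \<kappa> y \<longleftrightarrow> \<kappa>' x = \<kappa>' y"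
      show "total_self_sign \<kappa> OT = total_self_sign \<kappa>' ?OT' + 0"
      proof -
        have "\<kappa> e = \<kappa> b"
          using \<kappa>(1) by (auto simp: OT)
        moreover have "\<kappa>' e = \<kappa>' a" "\<kappa>' c = \<kappa>' b"
          using \<kappa>(2) by auto
        ultimately show ?thesis
          using \<kappa>(3)[of a b] \<kappa>(3)[of b a] by (simp add: OT)
      qed
    qed (cases u1; cases v1; simp add: OT unit_flow_def)+
  qed
  then show ?thesis by simp
qed

text \<open>
  Smoothing splits off the closed curve \<open>Arc e e\<close>, a component without crossings.
\<close>

lemma self_writhe_omega6:
  assumes "closed_code ([Arc b a, Arc e e] @ S)"
    "closed_code ([Arc a b] @ S)"
  shows "self_writhe ([Arc b a, Arc e e] @ S)
      = self_writhe ([Arc a b] @ S)"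
proof -
  let ?T = "[Arc b a, Arc e e]"
    and ?T' = "[Arc a b]"
  let ?bs = "[a, b]"
  have i: "has_interface ?T ?bs [e]" "has_interface ?T' ?bs []"
    by (simp_all add: has_interface_def)
  note neq = has_interface_neq[OF i(1) assms(1), simplified]
  have "self_writhe (?T @ S) = self_writhe (?T' @ S) + 0"
  proof (rule self_writhe_replace[OF assms i])
    show "invariants_extend [e] ?T' ?T"
      by (rule invariants_extendI[where h = "\<lambda>c. c"]) (use neq in auto)
    show "invariants_extend [] ?T ?T'"
      by (rule invariants_extendI[where h = "\<lambda>c. c"]) (use neq in auto)
  next
    fix OT :: "(nat piece \<times> bool \<times> bool) list"
    assume "map fst OT = ?T" and 0: "\<forall>x\<in>set [e]. total_outflow OT x = 0"
    then obtain u1 v1 u2 v2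
      where OT: "OT = [(Arc b a, u1, v1), (Arc e e, u2, v2)]"
      by (auto simp: map_fst_eq_Cons)
    let ?OT' = "[(Arc a b, \<not> u1, True)]"
    show "transferable ?bs 0 OT ?T'"
    proof (rule transferableI[where OT' = ?OT'])
    qed (cases u1; simp add: OT unit_flow_def)+
  qed
  then show ?thesis by simp
qed

lemma self_writhe_omega6':
  assumes "closed_code ([Arc a e, Arc b e] @ S)"
    "closed_code ([Arc a b] @ S)"
  shows "self_writhe ([Arc a e, Arc b e] @ S)
      = self_writhe ([Arc a b] @ S)"
proof -
  let ?T = "[Arc a e, Arc b e]"
    and ?T' = "[Arc a b]"
  let ?bs = "[a, b]"
  have i: "has_interface ?T ?bs [e]" "has_interface ?T' ?bs []"
    by (simp_all add: has_interface_def)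
  note neq = has_interface_neq[OF i(1) assms(1), simplified]
  have "self_writhe (?T @ S) = self_writhe (?T' @ S) + 0"
  proof (rule self_writhe_replace[OF assms i])
    show "invariants_extend [e] ?T' ?T"
      by (rule invariants_extendI[where h = "\<lambda>c. c(e := c a)"]) (use neq in auto)
    show "invariants_extend [] ?T ?T'"
      by (rule invariants_extendI[where h = "\<lambda>c. c"]) (use neq in auto)
  next
    fix OT :: "(nat piece \<times> bool \<times> bool) list"
    assume "map fst OT = ?T" and 0: "\<forall>x\<in>set [e]. total_outflow OT x = 0"
    then obtain u1 v1 u2 v2
      where OT: "OT = [(Arc a e, u1, v1), (Arc b e, u2, v2)]"
      by (auto simp: map_fst_eq_Cons)
    have flow: "total_outflow OT x = 0" if "x \<in> set [e]" for x
      using 0 that by blast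
    have e: "u2 = (\<not> u1)"
      using flow[of e] by (simp add: OT unit_flow_def neq split: if_splits)
    note OT = OT[unfolded e]
    let ?OT' = "[(Arc a b, u1, True)]"
    show "transferable ?bs 0 OT ?T'"
    proof (rule transferableI[where OT' = ?OT'])
    qed (cases u1; simp add: OT unit_flow_def)+
  qed
  then show ?thesis by simp
qed

text \<open>
  After smoothing, both sides consist of arcs joining \<open>t1\<close> to \<open>b1\<close>, \<open>t2\<close> to \<open>t3\<close> and \<open>b2\<close> to \<open>b3\<close>.
\<close>

lemma self_writhe_omega7:
  assumes "closed_code ([Arc b1 t1, Arc b2 e, Arc t2 t3, Arc e b3] @ S)"
    "closed_code ([Arc b1 t1, Arc e t2, Arc e t3, Arc b2 b3] @ S)"
  shows "self_writhe ([Arc b1 t1, Arc b2 e, Arc t2 t3, Arc e b3] @ S)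
      = self_writhe ([Arc b1 t1, Arc e t2, Arc e t3, Arc b2 b3] @ S)"
proof -
  let ?T = "[Arc b1 t1, Arc b2 e, Arc t2 t3, Arc e b3]"
    and ?T' = "[Arc b1 t1, Arc e t2, Arc e t3, Arc b2 b3]"
  let ?bs = "[t1, t2, t3, b1, b2, b3]"
  have i: "has_interface ?T ?bs [e]" "has_interface ?T' ?bs [e]"
    by (simp_all add: has_interface_def)
  note neq = has_interface_neq[OF i(1) assms(1), simplified]
  have "self_writhe (?T @ S) = self_writhe (?T' @ S) + 0"
  proof (rule self_writhe_replace[OF assms i])
    show "invariants_extend [e] ?T' ?T"
      by (rule invariants_extendI[where h = "\<lambda>c. c(e := c b2)"]) (use neq in auto)
    show "invariants_extend [e] ?T ?T'"
      by (rule invariants_extendI[where h = "\<lambda>c. c(e := c t2)"]) (use neq in auto)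
  next
    fix OT :: "(nat piece \<times> bool \<times> bool) list"
    assume "map fst OT = ?T" and 0: "\<forall>x\<in>set [e]. total_outflow OT x = 0"
    then obtain u1 v1 u2 v2 u3 v3 u4 v4
      where OT: "OT = [(Arc b1 t1, u1, v1), (Arc b2 e, u2, v2), (Arc t2 t3, u3, v3),
          (Arc e b3, u4, v4)]"
      by (auto simp: map_fst_eq_Cons)
    have flow: "total_outflow OT x = 0" if "x \<in> set [e]" for x
      using 0 that by blast
    have e: "u4 = u2"
      using flow[of e] by (simp add: OT unit_flow_def neq split: if_splits)
    note OT = OT[unfolded e]
    let ?OT' = "[(Arc b1 t1, u1, True), (Arc e t2, \<not> u3, True), (Arc e t3, u3, True),
        (Arc b2 b3, u2, True)]"
    show "transferable ?bs 0 OT ?T'"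
    proof (rule transferableI[where OT' = ?OT'])
    qed (cases u1; cases u2; cases u3; simp add: OT unit_flow_def)+
  qed
  then show ?thesis by simp
qed

text \<open>
  The arms of the right vertex form one arc from \<open>b1\<close> to \<open>b2\<close>, which crosses each of the two arcs
  of the left vertex forth and back.  On both sides the signs cancel in pairs.
\<close>

lemma self_writhe_omega8:
  assumes "closed_code ([Arc e1 t1, Arc f1 t2, Arc t3 t4, Arc g1 h1, Crossing f1 g1 g2 f2,
      Crossing e1 g2 b1 e2, Crossing f2 h1 h2 b4, Crossing e2 h2 b2 b3] @ S)"
    "closed_code ([Arc e1 t1, Arc f1 t2, Arc t3 t4, Arc g1 h1, CrossingNWSE f1 g1 g2 f2,
        CrossingNWSE e1 g2 b1 e2, CrossingNWSE f2 h1 h2 b4, CrossingNWSE e2 h2 b2 b3] @ S)"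
  shows "self_writhe ([Arc e1 t1, Arc f1 t2, Arc t3 t4, Arc g1 h1, Crossing f1 g1 g2 f2,
      Crossing e1 g2 b1 e2, Crossing f2 h1 h2 b4, Crossing e2 h2 b2 b3] @ S)
      = self_writhe ([Arc e1 t1, Arc f1 t2, Arc t3 t4, Arc g1 h1, CrossingNWSE f1 g1 g2 f2,
          CrossingNWSE e1 g2 b1 e2, CrossingNWSE f2 h1 h2 b4, CrossingNWSE e2 h2 b2 b3] @ S)"
proof -
  let ?T = "[Arc e1 t1, Arc f1 t2, Arc t3 t4, Arc g1 h1, Crossing f1 g1 g2 f2,
      Crossing e1 g2 b1 e2, Crossing f2 h1 h2 b4, Crossing e2 h2 b2 b3]"
    and ?T' = "[Arc e1 t1, Arc f1 t2, Arc t3 t4, Arc g1 h1, CrossingNWSE f1 g1 g2 f2,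
        CrossingNWSE e1 g2 b1 e2, CrossingNWSE f2 h1 h2 b4, CrossingNWSE e2 h2 b2 b3]"
  let ?bs = "[t1, t2, t3, t4, b1, b2, b3, b4]"
  have i: "has_interface ?T ?bs [e1, e2, f1, f2, g1, g2, h1, h2]"
      "has_interface ?T' ?bs [e1, e2, f1, f2, g1, g2, h1, h2]"
    by (simp_all add: has_interface_def)
  note neq = has_interface_neq[OF i(1) assms(1), simplified]
  have "self_writhe (?T @ S) = self_writhe (?T' @ S) + 0"
  proof (rule self_writhe_replace[OF assms i])
    show "invariants_extend [e1, e2, f1, f2, g1, g2, h1, h2] ?T' ?T"
      by (rule invariants_extendI[where h = "\<lambda>c. c"]) (use neq in auto)
    show "invariants_extend [e1, e2, f1, f2, g1, g2, h1, h2] ?T ?T'"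
      by (rule invariants_extendI[where h = "\<lambda>c. c"]) (use neq in auto)
  next
    fix OT :: "(nat piece \<times> bool \<times> bool) list"
    assume "map fst OT = ?T" and 0: "\<forall>x\<in>set [e1, e2, f1, f2, g1, g2, h1, h2]. total_outflow OT x = 0"
    then obtain u1 v1 u2 v2 u3 v3 u4 v4 u5 v5 u6 v6 u7 v7 u8 v8
      where OT: "OT = [(Arc e1 t1, u1, v1), (Arc f1 t2, u2, v2), (Arc t3 t4, u3, v3),
          (Arc g1 h1, u4, v4), (Crossing f1 g1 g2 f2, u5, v5), (Crossing e1 g2 b1 e2, u6, v6),
              (Crossing f2 h1 h2 b4, u7, v7), (Crossing e2 h2 b2 b3, u8, v8)]"
      by (auto simp: map_fst_eq_Cons)
    have flow: "total_outflow OT x = 0" if "x \<in> set [e1, e2, f1, f2, g1, g2, h1, h2]" for x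
      using 0 that by blast
    have e1: "v6 = (\<not> u1)"
      using flow[of e1] by (simp add: OT unit_flow_def neq split: if_splits)
    have f1: "v5 = (\<not> u2)"
      using flow[of f1] by (simp add: OT unit_flow_def neq split: if_splits)
    have g1: "u5 = (\<not> u4)"
      using flow[of g1] by (simp add: OT unit_flow_def neq split: if_splits)
    have h1: "u7 = u4"
      using flow[of h1] by (simp add: OT unit_flow_def neq split: if_splits)
    have g2: "u6 = u5"
      using flow[of g2] by (simp add: OT unit_flow_def neq split: if_splits)
    have f2: "v7 = v5"
      using flow[of f2] by (simp add: OT unit_flow_def neq split: if_splits)
    have e2: "v8 = v6"
      using flow[of e2] by (simp add: OT unit_flow_def neq split: if_splits)
    have h2: "u8 = u7"
      using flow[of h2] by (simp add: OT unit_flow_def neq split: if_splits)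
    note OT = OT[unfolded h2 e2 f2 g2 h1 g1 f1 e1]
    let ?OT' = "[(Arc e1 t1, u1, True), (Arc f1 t2, u2, True), (Arc t3 t4, u3, True),
        (Arc g1 h1, u4, True), (CrossingNWSE f1 g1 g2 f2, \<not> u2, u4), (CrossingNWSE e1 g2 b1 e2,
            \<not> u1, u4), (CrossingNWSE f2 h1 h2 b4, \<not> u2, \<not> u4), (CrossingNWSE e2 h2 b2 b3, \<not> u1,
                \<not> u4)]"
    show "transferable ?bs 0 OT ?T'"
    proof (rule transferableI[where OT' = ?OT'])
      fix \<kappa> \<kappa>' :: "nat naming"
      assume \<kappa>: "strand_invariant \<kappa> (map fst OT)" "strand_invariant \<kappa>' ?T'"
        "\<And>x y. x \<in> set ?bs \<Longrightarrow> y \<in> set ?bs \<Longrightarrow> \<kappa> x = \<kappa> y \<longleftrightarrow> \<kappa>' x = \<kappa>' y"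
      show "total_self_sign \<kappa> OT = total_self_sign \<kappa>' ?OT' + 0"
      proof -
        have "\<kappa> f2 = \<kappa> f1" "\<kappa> e2 = \<kappa> e1" "\<kappa> g2 = \<kappa> g1" "\<kappa> h1 = \<kappa> g1" "\<kappa> h2 = \<kappa> g1"
          using \<kappa>(1) by (auto simp: OT)
        moreover have "\<kappa>' f2 = \<kappa>' f1" "\<kappa>' e2 = \<kappa>' e1" "\<kappa>' g2 = \<kappa>' g1" "\<kappa>' h1 = \<kappa>' g1"
            "\<kappa>' h2 = \<kappa>' g1" "\<kappa>' b1 = \<kappa>' g1" "\<kappa>' b2 = \<kappa>' g1"
          using \<kappa>(2) by auto
        ultimately show ?thesis
          by (simp add: OT)
      qed
    qed (cases u1; cases u2; cases u3; cases u4; simp add: OT unit_flow_def)+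
  qed
  then show ?thesis by simp
qed

section \<open>Invariance\<close>

lemma positive_resolution_simps [simp]:
  "positive_resolution [] = []"
  "positive_resolution (P # D) = smooth P @ positive_resolution D"
  "positive_resolution (D @ E) = positive_resolution D @ positive_resolution E"
  by (simp_all add: positive_resolution_def)

text \<open>
  Smoothing regroups the ends of a vertex, so it preserves closedness, boundary and interior labels.
\<close>

lemma ends_positive_resolution:
  "mset (concat (map ends (positive_resolution D))) = mset (concat (map ends D))"
proof (induction D)
  case (Cons P D)
  have "mset (concat (map ends (smooth P))) = mset (ends P)" by (cases P) auto
  then show ?case using Cons by simp
qed simp

lemma labels_positive_resolution [simp]: "labels (positive_resolution D) = labels D"
  using arg_cong[OF ends_positive_resolution[of D], of set_mset]
  by (simp only: set_mset_mset set_concat_ends)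

lemma closed_positive_resolution [simp]: "closed_code (positive_resolution D) = closed_code D"
  unfolding closed_code_iff end_count_def ends_positive_resolution labels_positive_resolution ..

lemma positive_resolution_map_piece:
  "positive_resolution (map (map_piece f) D) = map (map_piece f) (positive_resolution D)"
proof (induction D)
  case (Cons P D)
  then show ?case by (cases P) auto
qed simp

lemma mset_positive_resolution:
  "mset D = mset E \<Longrightarrow> mset (positive_resolution D) = mset (positive_resolution E)"
proof -
  have "mset (positive_resolution D) = (\<Sum>P\<in>#mset D. mset (smooth P))" for D :: diagram
    by (induction D) auto
  then show "mset D = mset E \<Longrightarrow> mset (positive_resolution D) = mset (positive_resolution E)" by simp
qed

lemma self_writhe_flip_arc:
  assumes "closed_code (Arc p q # S)" "closed_code (Arc q p # S)"
  shows "self_writhe (Arc p q # S) = self_writhe (Arc q p # S)"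
proof -
  have "self_writhe ([Arc p q] @ S) = self_writhe ([Arc q p] @ S) + 0"
  proof (rule self_writhe_replace[where bs = "[p, q]" and js = "[]" and js' = "[]"])
    show "invariants_extend [] [Arc q p] [Arc p q]" "invariants_extend [] [Arc p q] [Arc q p]"
      by (rule invariants_extendI[where h = "\<lambda>g. g"]; simp)+
  next
    fix OT :: "(nat piece \<times> bool \<times> bool) list"
    assume "map fst OT = [Arc p q]"
    then obtain u v where OT: "OT = [(Arc p q, u, v)]" by (auto simp: map_fst_eq_Cons)
    show "transferable [p, q] 0 OT [Arc q p]"
      by (rule transferableI[where OT' = "[(Arc q p, \<not> u, v)]"]) (simp_all add: OT unit_flow_def)
  qed (use assms in \<open>simp_all add: has_interface_def\<close>)
  then show ?thesis by simp
qed

lemma self_writhe_turn_crossing: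
  assumes "closed_code (Crossing a b c d # S)" "closed_code (Crossing d c b a # S)"
  shows "self_writhe (Crossing a b c d # S) = self_writhe (Crossing d c b a # S)"
proof -
  let ?T = "[Crossing a b c d]" and ?T' = "[Crossing d c b a]"
  have "self_writhe (?T @ S) = self_writhe (?T' @ S) + 0"
  proof (rule self_writhe_replace[where bs = "[a, b, c, d]" and js = "[]" and js' = "[]"])
    show "invariants_extend [] ?T' ?T" "invariants_extend [] ?T ?T'"
      by (rule invariants_extendI[where h = "\<lambda>g. g"]; simp)+
  next
    fix OT :: "(nat piece \<times> bool \<times> bool) list"
    assume "map fst OT = ?T"
    then obtain u v where OT: "OT = [(Crossing a b c d, u, v)]" by (auto simp: map_fst_eq_Cons)
    show "transferable [a, b, c, d] 0 OT ?T'"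
      by (rule transferableI[where OT' = "[(Crossing d c b a, \<not> u, \<not> v)]"])
        (auto simp: OT unit_flow_def)
  qed (use assms in \<open>simp_all add: has_interface_def\<close>)
  then show ?thesis by simp
qed

text \<open>
  The effect on the smoothed diagram of turning a vertex by a half turn.
\<close>

lemma self_writhe_swap_flip_arcs:
  assumes "closed_code (Arc a b # Arc c d # S)" "closed_code (Arc d c # Arc b a # S)"
  shows "self_writhe (Arc a b # Arc c d # S) = self_writhe (Arc d c # Arc b a # S)"
proof -
  let ?T = "[Arc a b, Arc c d]" and ?T' = "[Arc d c, Arc b a]"
  have "self_writhe (?T @ S) = self_writhe (?T' @ S) + 0"
  proof (rule self_writhe_replace[where bs = "[a, b, c, d]" and js = "[]" and js' = "[]"])
    show "invariants_extend [] ?T' ?T" "invariants_extend [] ?T ?T'"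
      by (rule invariants_extendI[where h = "\<lambda>g. g"]; simp)+
  next
    fix OT :: "(nat piece \<times> bool \<times> bool) list"
    assume "map fst OT = ?T"
    then obtain u v u' v' where OT: "OT = [(Arc a b, u, v), (Arc c d, u', v')]"
      by (auto simp: map_fst_eq_Cons)
    show "transferable [a, b, c, d] 0 OT ?T'"
      by (rule transferableI[where OT' = "[(Arc d c, \<not> u', v'), (Arc b a, \<not> u, v)]"])
        (simp_all add: OT unit_flow_def)
  qed (use assms in \<open>simp_all add: has_interface_def\<close>)
  then show ?thesis by simp
qed

lemma t_plus_recode:
  assumes "recode D E" "closed_code D" "closed_code E"
  shows "t_plus D = t_plus E"
  using assms
proof (induction rule: recode.induct)
  case (permute D E)
  then show ?case unfolding t_plus_def
    by (intro self_writhe_permute mset_positive_resolution) simp_all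
next
  case (rename f D)
  then have "closed_code (map (map_piece f) (positive_resolution D))"
    by (simp flip: positive_resolution_map_piece)
  then show ?case using rename unfolding t_plus_def positive_resolution_map_piece
    by (intro self_writhe_rename[symmetric]) simp_all
next
  case (flip_arc p q D)
  then have "closed_code (positive_resolution (Arc p q # D))"
    "closed_code (positive_resolution (Arc q p # D))"
    by (simp_all only: closed_positive_resolution)
  then show ?case unfolding t_plus_def by (simp add: self_writhe_flip_arc)
next
  case (turn_crossing a b c d D)
  then have "closed_code (positive_resolution (Crossing a b c d # D))"
    "closed_code (positive_resolution (Crossing d c b a # D))"
    by (simp_all only: closed_positive_resolution)
  then show ?case unfolding t_plus_def by (simp add: self_writhe_turn_crossing)
next
  case (turn_vertex a b c d D)
  then have "closed_code (positive_resolution (Vertex a b c d # D))"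
    "closed_code (positive_resolution (Vertex d c b a # D))"
    by (simp_all only: closed_positive_resolution)
  then show ?case unfolding t_plus_def by (simp add: self_writhe_swap_flip_arcs)
next
  case (remove_point p q D)
  then have "closed_code (positive_resolution (Arc p q # D))"
    "closed_code (positive_resolution (map (map_piece (id(q := p))) D))"
    by (simp_all only: closed_positive_resolution)
  then show ?case using remove_point(1) self_writhe_remove_point[of p q "positive_resolution D"]
    unfolding t_plus_def by (simp add: positive_resolution_map_piece)
qed

lemma t_plus_local_move:
  assumes "local_move m T T'" "closed_code (T @ S)" "closed_code (T' @ S)"
  shows "t_plus (T @ S) = t_plus (T' @ S) + (if m = Omega1 then 1 else 0)"
proof -
  let ?S = "positive_resolution S"
  have "closed_code (positive_resolution T @ ?S)" "closed_code (positive_resolution T' @ ?S)"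
    using assms(2,3) by (simp_all flip: positive_resolution_simps(3))
  with assms(1) show ?thesis
    unfolding t_plus_def positive_resolution_simps(3)
  proof (induction rule: local_move.induct)
    case (omega1 a e b)
    then show ?case by (simp, intro self_writhe_omega1[simplified append_Cons append_Nil])
  next
    case (omega2 a c e f b d)
    then show ?case by (simp, intro self_writhe_omega2[simplified append_Cons append_Nil])
  next
    case (omega3 t1 t2 e f h1 g b1 h2 b2)
    then show ?case by (simp, intro self_writhe_omega3[simplified append_Cons append_Nil])
  next
    case (omega4 t1 t2 e f h1 g b1 h2 b2)
    then show ?case by (simp, intro self_writhe_omega4[simplified append_Cons append_Nil])
  next
    case (omega4' t1 t2 e f h1 g b1 h2 b2)
    then show ?case by (simp, intro self_writhe_omega4'[simplified append_Cons append_Nil])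
  next
    case (omega5 a e b f c d)
    then show ?case by (simp, intro self_writhe_omega5[simplified append_Cons append_Nil])
  next
    case (omega6 a e b)
    then show ?case by (simp, intro self_writhe_omega6[simplified append_Cons append_Nil])
  next
    case (omega6' a e b)
    then show ?case by (simp, intro self_writhe_omega6'[simplified append_Cons append_Nil])
  next
    case (omega7 t1 e b1 b2 t2 t3 b3)
    then show ?case by (simp, intro self_writhe_omega7[simplified append_Cons append_Nil])
  next
    case (omega8 t1 t2 e1 f1 t3 t4 g1 h1 g2 f2 b1 e2 h2 b4 b2 b3)
    then show ?case by (simp, intro self_writhe_omega8[simplified append_Cons append_Nil])
  qed
qed

lemma zpow_add: "zpow (m + n) = zpow m * zpow n"
  by (simp add: zpow_def mult_single)

lemma zpow_0 [simp]: "zpow 0 = 1"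
  by (simp add: zpow_def)

lemma R_prime_recode:
  assumes "recode D E" "marked_graph_diagram D" "marked_graph_diagram E"
  shows "R_prime D = R_prime E"
  using assms t_plus_recode[of D E] bracket_recode[of D E "0 :: laurent" 0 "zpow 1" "zpow (- 1)"]
  by (simp add: R_prime_def marked_graph_diagram_def)

text \<open>
  Isotopies run through marked graph diagrams only, so the property of being one is carried along
  with the invariant; this is how closedness reaches the two diagrams of a move.
\<close>

lemma isotopic_invariant:
  assumes "isotopic D E"
  shows "R_prime D = R_prime E" "marked_graph_diagram D \<longleftrightarrow> marked_graph_diagram E"
proof -
  have "R_prime D = R_prime E \<and> (marked_graph_diagram D \<longleftrightarrow> marked_graph_diagram E)"
    using assms unfolding isotopic_def
    by (induction rule: equivclp_induct) (auto dest: R_prime_recode)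
  then show "R_prime D = R_prime E" "marked_graph_diagram D \<longleftrightarrow> marked_graph_diagram E" by auto
qed

text \<open>
  The kink of \<open>\<Omega>\<^sub>1\<close> multiplies the first factor by \<open>z\<close> and the second by \<open>z\<^sup>-\<^sup>1\<close>.
\<close>

lemma R_prime_local_move:
  assumes move: "local_move m T T'" and closed: "closed_code (T @ S)" "closed_code (T' @ S)"
  shows "R_prime (T @ S) = R_prime (T' @ S)"
proof -
  have zw: "zpow 1 * zpow (- 1) = 1" by (simp flip: zpow_add)
  have "R_prime (T @ S) = zpow (t_plus (T' @ S) + (if m = Omega1 then 1 else 0)) *
      ((if m = Omega1 then zpow (- 1) else 1) * bracket (T' @ S) 0 0 (zpow 1) (zpow (- 1)))"
    unfolding R_prime_def t_plus_local_move[OF assms] bracket_local_move[OF assms zw] ..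
  also have "\<dots> = R_prime (T' @ S)"
    using zw by (simp add: R_prime_def zpow_add mult.assoc)
  finally show ?thesis .
qed

theorem theorem4p4:
  fixes D D' :: diagram and m :: move
  assumes "marked_graph_diagram D" and "marked_graph_diagram D'"
    and "yoshikawa_move m D D'"
  shows "R_prime D' = R_prime D"
proof -
  obtain T T' S where move: "local_move m T T' \<or> local_move m T' T"
    and iso: "isotopic D (T @ S)" "isotopic (T' @ S) D'"
    using assms(3) unfolding yoshikawa_move_def by blast
  have "closed_code (T @ S)" "closed_code (T' @ S)"
    using isotopic_invariant(2)[OF iso(1)] isotopic_invariant(2)[OF iso(2)] assms(1,2)
    by (simp_all add: marked_graph_diagram_def)
  then have "R_prime (T @ S) = R_prime (T' @ S)"
    using move R_prime_local_move by metis
  then show ?thesis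
    using isotopic_invariant(1)[OF iso(1)] isotopic_invariant(1)[OF iso(2)] by simp
qed

end
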